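(* Let $\lambda>0$, $\phi>0$, $\gamma>0$, $0<\rho\le 1$, $0<\mu\le 1$, with $0<\mu\lceil\gamma\rceil/\gamma-r\rho<1$ for all $r=0,\dots,\lceil\gamma\rceil$. Let $N(t)$, $t\ge0$, be the generalized fractional Poisson process with these parameters, and let $\mathfrak{E}_t=\inf\{s\ge 0:\mathfrak{V}_s>t\}$, $t\ge0$, be the hitting-time process of $$\mathfrak{V}_t=\sum_{r=0}^{\lceil\gamma\rceil}{}_rV^{\,\mu\frac{\lceil\gamma\rceil}{\gamma}-r\rho}_{\Phi_r(t)},\qquad \Phi_r(t)=\binom{\lceil\gamma\rceil}{r}\phi^r\,V_t^{\frac{\gamma}{\lceil\gamma\rceil}},\qquad t\ge 0.$$ Let $\mathcal{N}(t)$, $t\ge0$, be a homogeneous Poisson process of parameter $\lambda$, independent of $\mathfrak{E}_t$. Then $$N(t)=\mathcal{N}(\mathfrak{E}_t),\qquad t\ge 0,$$ holds in distribution (for each fixed $t$).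
   Context: For $\alpha\in(0,1)$, a stable subordinator $V^{\alpha}_t$ of index $\alpha$ is the nondecreasing Lévy process with $\mathbb{E}e^{-sV^{\alpha}_t}=e^{-ts^{\alpha}}$, $s>0$; for $\alpha=1$, $V^1_t=t$. In the definition of $\mathfrak{V}_t$, the processes ${}_rV^{\mu\lceil\gamma\rceil/\gamma-r\rho}$, $r=0,\dots,\lceil\gamma\rceil$, are independent stable subordinators of the indicated indices, and $V^{\gamma/\lceil\gamma\rceil}$ is a further stable subordinator, independent of the others (the same one for all $r$). The three-parameter Mittag--Leffler function is $E^{\gamma}_{\rho,\mu}(x)=\sum_{k=0}^{\infty}\frac{\Gamma(\gamma+k)}{\Gamma(\gamma)\Gamma(\rho k+\mu)}\frac{x^k}{k!}$, where $\Gamma(\gamma+k)/\Gamma(\gamma)$ is read as the Pochhammer symbol $\gamma(\gamma+1)\cdots(\gamma+k-1)$. The generalized fractional Poisson process $N(t)$ is the $\{0,1,2,\dots\}$-valued process whose state probabilities $p_k(t)=\Pr(N(t)=k)$ solve ${}^C\mathcal{D}^{\gamma,\mu}_{\rho,-\phi,0^+}p_k(t)=-\lambda p_k(t)+\lambda p_{k-1}(t)$, $k\ge0$ (with $p_{-1}\equiv0$), $p_0(0)=1$, $p_k(0)=0$ for $k\ge1$, where ${}^C\mathcal{D}^{\gamma,\mu}_{\rho,\omega,0^+}f(t)=\int_0^t(t-y)^{-\mu}E^{-\gamma}_{\rho,1-\mu}[\omega(t-y)^{\rho}]f'(y)\,dy$. Equivalently, its probability generating function is $\sum_{k\ge0}v^kp_k(t)=\sum_{k=0}^{\infty}(-\lambda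 t^{\mu})^k(1-v)^kE^{\gamma k}_{\rho,\mu k+1}(-\phi t^{\rho})$, $|v|\le1$. *)

theory Defs
  imports "HOL-Probability.Probability"
begin

text \<open>
  Processes are indexed by all reals; only their restriction to times \<open>t \<ge> 0\<close> matters.
  Path properties are required almost surely only.
\<close>

definition sample_path :: "(real \<Rightarrow> 'a \<Rightarrow> 'b) \<Rightarrow> 'a \<Rightarrow> real \<Rightarrow> 'b" where
  "sample_path X \<omega> = (\<lambda>t\<in>{0..}. X t \<omega>)"

definition cadlag :: "(real \<Rightarrow> real) \<Rightarrow> bool" where
  "cadlag f \<longleftrightarrow>
     (\<forall>t\<ge>0. continuous (at_right t) f) \<and> (\<forall>t>0. \<exists>l. (f \<longlongrightarrow> l) (at_left t))"

definition levy_process :: "'a measure \<Rightarrow> (real \<Rightarrow> 'a \<Rightarrow> real) \<Rightarrow> bool" where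
  "levy_process M X \<longleftrightarrow>
     prob_space M \<and>
     (\<forall>t\<ge>0. X t \<in> borel_measurable M) \<and>
     (AE \<omega> in M. X 0 \<omega> = 0) \<and>
     (\<forall>(\<tau> :: nat \<Rightarrow> real) n. 0 \<le> \<tau> 0 \<longrightarrow> (\<forall>i<n. \<tau> i \<le> \<tau> (Suc i)) \<longrightarrow>
        prob_space.indep_vars M (\<lambda>_. borel) (\<lambda>i \<omega>. X (\<tau> (Suc i)) \<omega> - X (\<tau> i) \<omega>) {..<n}) \<and>
     (\<forall>s\<ge>0. \<forall>h\<ge>0. distr M borel (\<lambda>\<omega>. X (s + h) \<omega> - X s \<omega>) = distr M borel (X h)) \<and>
     (AE \<omega> in M. cadlag (\<lambda>t. X t \<omega>))"

definition stable_subordinator :: "'a measure \<Rightarrow> real \<Rightarrow> (real \<Rightarrow> 'a \<Rightarrow> real) \<Rightarrow> bool" where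
  "stable_subordinator M \<alpha> V \<longleftrightarrow>
     0 < \<alpha> \<and> \<alpha> \<le> 1 \<and>
     levy_process M V \<and>
     (AE \<omega> in M. mono_on {0..} (\<lambda>t. V t \<omega>)) \<and>
     (if \<alpha> = 1 then AE \<omega> in M. \<forall>t\<ge>0. V t \<omega> = t
      else \<forall>t\<ge>0. \<forall>s>0. (LINT \<omega>|M. exp (- s * V t \<omega>)) = exp (- t * s powr \<alpha>))"

definition poisson_process :: "'a measure \<Rightarrow> real \<Rightarrow> (real \<Rightarrow> 'a \<Rightarrow> nat) \<Rightarrow> bool" where
  "poisson_process M \<Lambda> P \<longleftrightarrow>
     levy_process M (\<lambda>t \<omega>. real (P t \<omega>)) \<and>
     (\<forall>t\<ge>0. \<forall>k. measure M {\<omega> \<in> space M. P t \<omega> = k} =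
        (\<Lambda> * t) ^ k / fact k * exp (- \<Lambda> * t))"

text \<open>
  The coefficient \<open>1 / Gamma z\<close> is \<open>0\<close> at the poles of \<open>Gamma\<close>, as usual.
\<close>

definition mittag_leffler3 :: "real \<Rightarrow> real \<Rightarrow> real \<Rightarrow> real \<Rightarrow> real" where
  "mittag_leffler3 \<gamma> \<rho> \<mu> x =
     (\<Sum>k. pochhammer \<gamma> k / Gamma (\<rho> * real k + \<mu>) * (x ^ k / fact k))"

definition caputo_prabhakar_integrand ::
    "real \<Rightarrow> real \<Rightarrow> real \<Rightarrow> real \<Rightarrow> (real \<Rightarrow> real) \<Rightarrow> real \<Rightarrow> real \<Rightarrow> real" where
  "caputo_prabhakar_integrand \<gamma> \<mu> \<rho> w f t y =
     (t - y) powr (- \<mu>) * mittag_leffler3 (- \<gamma>) \<rho> (1 - \<mu>) (w * (t - y) powr \<rho>) * deriv f y"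

text \<open>
  This integral formula is the regularized Prabhakar derivative for \<open>0 < \<mu> < 1\<close>.
  For \<open>\<mu> = 1\<close> the leading term of the kernel would have to be read as a Dirac mass.
\<close>

definition caputo_prabhakar ::
    "real \<Rightarrow> real \<Rightarrow> real \<Rightarrow> real \<Rightarrow> (real \<Rightarrow> real) \<Rightarrow> real \<Rightarrow> real" where
  "caputo_prabhakar \<gamma> \<mu> \<rho> w f t =
     (LINT y:{0<..<t}|lborel. caputo_prabhakar_integrand \<gamma> \<mu> \<rho> w f t y)"

definition state_prob :: "'a measure \<Rightarrow> (real \<Rightarrow> 'a \<Rightarrow> nat) \<Rightarrow> nat \<Rightarrow> real \<Rightarrow> real" where
  "state_prob M N k t = measure M {\<omega> \<in> space M. N t \<omega> = k}"

text \<open>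
  A solution of the Cauchy problem is continuous on \<open>[0, \<infinity>)\<close> (so that the initial values are
  attained), differentiable on \<open>(0, \<infinity>)\<close>, and has a well-defined fractional derivative at every
  \<open>t > 0\<close>. The equation cannot be required at \<open>t = 0\<close>, where the integral is \<open>0\<close>.
\<close>

definition generalized_fractional_poisson_process ::
    "'a measure \<Rightarrow> real \<Rightarrow> real \<Rightarrow> real \<Rightarrow> real \<Rightarrow> real \<Rightarrow> (real \<Rightarrow> 'a \<Rightarrow> nat) \<Rightarrow> bool" where
  "generalized_fractional_poisson_process M \<Lambda> \<phi> \<gamma> \<rho> \<mu> N \<longleftrightarrow>
     prob_space M \<and>
     (\<forall>t\<ge>0. N t \<in> measurable M (count_space UNIV)) \<and>
     (\<forall>k. state_prob M N k 0 = (if k = 0 then 1 else 0) \<and>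
        continuous_on {0..} (state_prob M N k) \<and>
        (\<forall>t>0. state_prob M N k differentiable at t \<and>
           set_integrable lborel {0<..<t}
             (caputo_prabhakar_integrand \<gamma> \<mu> \<rho> (- \<phi>) (state_prob M N k) t) \<and>
           caputo_prabhakar \<gamma> \<mu> \<rho> (- \<phi>) (state_prob M N k) t =
             - \<Lambda> * state_prob M N k t
             + \<Lambda> * (if k = 0 then 0 else state_prob M N (k - 1) t)))"

text \<open>
  In the next definition \<open>U r\<close> is the \<open>r\<close>-th outer subordinator and \<open>W\<close> the common inner one.
\<close>

definition subordinated_sum ::
    "real \<Rightarrow> real \<Rightarrow> (nat \<Rightarrow> real \<Rightarrow> 'a \<Rightarrow> real) \<Rightarrow> (real \<Rightarrow> 'a \<Rightarrow> real) \<Rightarrow> real \<Rightarrow> 'a \<Rightarrow> real" where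
  "subordinated_sum \<gamma> \<phi> U W t \<omega> =
     (\<Sum>r = 0..nat \<lceil>\<gamma>\<rceil>. U r (real (nat \<lceil>\<gamma>\<rceil> choose r) * \<phi> ^ r * W t \<omega>) \<omega>)"

definition hitting_time :: "(real \<Rightarrow> 'a \<Rightarrow> real) \<Rightarrow> real \<Rightarrow> 'a \<Rightarrow> real" where
  "hitting_time X t \<omega> = Inf {s. 0 \<le> s \<and> X s \<omega> > t}"

text \<open>
  Mutual independence of \<open>W\<close> and \<open>U 0, \<dots>, U n\<close> as processes; \<open>None\<close> is the index of \<open>W\<close>.
\<close>

definition indep_subordinators ::
    "'a measure \<Rightarrow> nat \<Rightarrow> (nat \<Rightarrow> real \<Rightarrow> 'a \<Rightarrow> real) \<Rightarrow> (real \<Rightarrow> 'a \<Rightarrow> real) \<Rightarrow> bool" where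
  "indep_subordinators M n U W \<longleftrightarrow>
     prob_space.indep_vars M (\<lambda>_. \<Pi>\<^sub>M t\<in>{0..}. borel)
       (\<lambda>i. sample_path (case i of None \<Rightarrow> W | Some r \<Rightarrow> U r)) (insert None (Some ` {0..n}))"

text \<open>
  Since path properties hold only almost surely, a hitting time, and a process evaluated at it,
  are measurable only up to null sets; hence the completion of \<open>M\<close>. In particular the
  value of \<open>Inf {}\<close> in \<open>hitting_time\<close> is immaterial when the hitting time is almost surely finite.
\<close>

definition indep_of_hitting_time ::
    "'a measure \<Rightarrow> (real \<Rightarrow> 'a \<Rightarrow> nat) \<Rightarrow> (real \<Rightarrow> 'a \<Rightarrow> real) \<Rightarrow> bool" where
  "indep_of_hitting_time M P E \<longleftrightarrow>
     prob_space.indep_var (completion M)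
       (\<Pi>\<^sub>M t\<in>{0..}. borel) (sample_path (\<lambda>t \<omega>. real (P t \<omega>)))
       (\<Pi>\<^sub>M t\<in>{0..}. borel) (sample_path E)"

end

theory Submission
  imports Defs
begin

text \<open>
  Both sides are laws on the natural numbers, so it is enough that their point probabilities agree,
  and these are recognised by their Laplace transforms in \<open>t\<close>. With
  \<open>\<psi>(u) = u\<^sup>\<mu> (1 + \<phi> u\<^sup>-\<^sup>\<rho>)\<^sup>\<gamma>\<close>, both transforms are
  \<open>\<psi>(u) \<Lambda>\<^sup>k / (u (\<psi>(u) + \<Lambda>)\<^sup>k\<^sup>+\<^sup>1)\<close>.

  On the side of the Cauchy problem, integrating the Prabhakar kernel term by term and summing by the
  generalised binomial theorem gives the transform \<open>\<psi>(u) / u\<close> for all large \<open>u\<close>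
  (\<open>kernel_laplace\<close>). A priori the derivatives of the state probabilities
  may grow too fast to have Laplace transforms, so the equation is first integrated over \<open>[0, t]\<close>, which
  replaces \<open>p\<^sub>k'\<close> by the bounded function \<open>p\<^sub>k - p\<^sub>k(0)\<close>
  (\<open>integral_of_convolution\<close>). The transform of the integrated equation is a recursion in
  \<open>k\<close> with the stated solution (\<open>laplace_state_probabilities\<close>).

  On the probabilistic side, conditioning on the inner subordinator gives
  \<open>E exp (- u V\<^sub>s) = exp (- s \<psi>(u))\<close> for the subordinated sum \<open>V\<close>: with
  \<open>n = \<lceil>\<gamma>\<rceil>\<close>, the exponents of the outer subordinators add up to
  \<open>u\<close> to the power \<open>\<mu> n / \<gamma>\<close> times \<open>(1 + \<phi> u\<^sup>-\<^sup>\<rho>)\<^sup>n\<close> by the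
  binomial theorem, and the inner subordinator raises this to the power \<open>\<gamma> / n\<close>
  (\<open>laplace_V\<close>). The hitting time \<open>E\<close> is the inverse of \<open>V\<close>, that is,
  \<open>s < E\<^sub>t\<close> holds exactly if \<open>V\<^sub>s \<le> t\<close>, up to boundary cases. Hence
  \<open>E h(E\<^sub>t)\<close>, written as \<open>h(0)\<close> plus the integral of \<open>h'(s) P(s < E\<^sub>t)\<close> over
  \<open>s > 0\<close>, has a transform that only involves \<open>\<psi>\<close>
  (\<open>laplace_of_inverse_process\<close>). By independence, the probability that the time-changed Poisson
  process equals \<open>k\<close> is \<open>E h(E\<^sub>t)\<close> for the Poisson weight
  \<open>h(x) = (\<Lambda> x)\<^sup>k exp (- \<Lambda> x) / k!\<close>
  (\<open>poisson_process_at_independent_time\<close>).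

  The two functions of \<open>t\<close> are bounded and right-continuous, and their transforms agree for all
  large \<open>u\<close>, so they are equal (\<open>laplace_transform_unique\<close>).
\<close>

section \<open>Laplace transforms determine right-continuous functions\<close>

lemma has_bochner_integral_powr_exp:
  fixes a u :: real
  assumes "a > -1" and "u > 0"
  shows "has_bochner_integral lborel (\<lambda>x. indicator {0<..} x * (x powr a * exp (- u * x)))
           (Gamma (a + 1) * u powr (- (a + 1)))"
proof -
  define h where "h = (\<lambda>x::real. if x \<in> {0..} then x powr a / exp x else 0)"
  have "(h has_integral Gamma (a + 1)) UNIV"
    unfolding h_def has_integral_restrict_UNIV using Gamma_integral_real[of "a + 1"] assms by simp
  moreover have "h \<in> borel_measurable borel" unfolding h_def by measurable
  moreover have "h x \<ge> 0" for x by (simp add: h_def)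
  moreover have "Gamma (a + 1) \<ge> 0" using assms by (intro Gamma_real_nonneg) auto
  ultimately have "has_bochner_integral lborel h (Gamma (a + 1))"
    by (intro has_bochner_integral_nn_integral nn_integral_has_integral_lborel) auto
  then have "has_bochner_integral lborel (\<lambda>x. h (0 + u * x)) (Gamma (a + 1) /\<^sub>R \<bar>u\<bar>)"
    using assms lborel_has_bochner_integral_real_affine_iff[of u h "Gamma (a + 1)" 0] by simp
  then have "has_bochner_integral lborel (\<lambda>x. u powr (- a) * h (u * x)) (u powr (- a) * (Gamma (a + 1) / u))"
    using assms by (intro has_bochner_integral_mult_right) (simp_all add: divide_inverse mult.commute)
  moreover have "u powr (- a) * (Gamma (a + 1) / u) = Gamma (a + 1) * u powr (- (a + 1))"
    using assms by (simp add: powr_diff powr_minus field_simps powr_add)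
  moreover have "u powr (- a) * h (u * x) = indicator {0<..} x * (x powr a * exp (- u * x))" for x
    using assms
    by (cases "x = 0") (auto simp: h_def indicator_def powr_mult powr_minus exp_minus field_simps mult_less_0_iff zero_le_mult_iff)
  ultimately show ?thesis by simp
qed

text \<open>
  In the variable \<open>x = exp (- t)\<close>, the Laplace transforms at \<open>u0\<close>, \<open>u0 + 1\<close>,
  \<open>u0 + 2\<close> and so on are the moments in \<open>x\<close> of the signed measure \<open>exp (- u0 t) f(t) dt\<close>. If
  all moments vanish, then the Weierstrass theorem makes this measure orthogonal to every
  continuous function of \<open>x\<close>, in particular to a bump just to the right of a point where
  \<open>f\<close> is nonzero.
\<close>

lemma laplace_transform_unique:
  fixes f :: "real \<Rightarrow> real"
  assumes meas: "(\<lambda>t. indicator {0<..} t * f t) \<in> borel_measurable lborel"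
    and bound: "\<And>t. t > 0 \<Longrightarrow> \<bar>f t\<bar> \<le> B"
    and rc: "\<And>t. t \<ge> 0 \<Longrightarrow> continuous (at_right t) f"
    and zero: "\<And>u. u \<ge> u0 \<Longrightarrow> (LINT t:{0<..}|lborel. exp (- u * t) * f t) = 0"
    and "u0 > 0" and "t \<ge> 0"
  shows "f t = 0"
proof (rule ccontr)
  assume "f t \<noteq> 0"
  have B: "B \<ge> 0" using bound[of 1] by auto
  define g where "g = (\<lambda>x. exp (- u0 * x) * (indicator {0<..} x * f x))"
  have exp_int: "integrable lborel (\<lambda>x. indicator {0<..} x * exp (- u0 * x))"
    using integrable_I0i_exp_mscale[OF \<open>u0 > 0\<close>] by (simp add: set_integrable_def mult.commute)
  have g_int: "integrable lborel g"
  proof (rule Bochner_Integration.integrable_bound[of _ "\<lambda>x. B * (indicator {0<..} x * exp (- u0 * x))"])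
    show "g \<in> borel_measurable lborel"
      unfolding g_def using meas by measurable
    show "AE x in lborel. norm (g x) \<le> norm (B * (indicator {0<..} x * exp (- u0 * x)))"
      using bound B by (auto simp: g_def indicator_def abs_mult mult.commute intro!: mult_right_mono)
  qed (use exp_int in auto)
  have g0: "g x = 0" if "x \<le> 0" for x using that by (simp add: g_def)
  have weighted_int: "integrable lborel (\<lambda>x. \<phi> (exp (- x)) * g x)"
    if \<phi>: "continuous_on UNIV \<phi>" for \<phi> :: "real \<Rightarrow> real"
  proof -
    have "compact (\<phi> ` {0..1})"
      by (intro compact_continuous_image continuous_on_subset[OF \<phi>]) auto
    then obtain D where D: "\<And>y. y \<in> {0..1} \<Longrightarrow> \<bar>\<phi> y\<bar> \<le> D"
      using compact_imp_bounded bounded_iff by (metis imageI real_norm_def)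
    have [measurable]: "\<phi> \<in> borel_measurable borel"
      using \<phi> by (rule borel_measurable_continuous_onI)
    have [measurable]: "g \<in> borel_measurable lborel" using g_int by auto
    show ?thesis
    proof (rule Bochner_Integration.integrable_bound[of _ "\<lambda>x. D * g x"])
      show "AE x in lborel. norm (\<phi> (exp (- x)) * g x) \<le> norm (D * g x)"
      proof (rule AE_I2)
        fix x :: real
        show "norm (\<phi> (exp (- x)) * g x) \<le> norm (D * g x)"
        proof (cases "x > 0")
          case True
          then have "\<bar>\<phi> (exp (- x))\<bar> \<le> \<bar>D\<bar>" using D[of "exp (- x)"] by auto
          then show ?thesis by (simp add: abs_mult mult_right_mono)
        qed (simp add: g0)
      qed
    qed (use g_int in auto)
  qed
  have monom: "(LINT x|lborel. exp (- x) ^ i * g x) = 0" for i :: nat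
  proof -
    have "exp (- x) ^ i * g x = indicator {0<..} x *\<^sub>R (exp (- (u0 + i) * x) * f x)" for x
      by (simp add: g_def exp_of_nat_mult[symmetric] exp_add[symmetric] algebra_simps indicator_def)
    then show ?thesis
      using zero[of "u0 + i"] by (simp add: set_lebesgue_integral_def)
  qed
  have cont: "(LINT x|lborel. \<phi> (exp (- x)) * g x) = 0"
    if \<phi>: "continuous_on UNIV \<phi>" for \<phi> :: "real \<Rightarrow> real"
  proof -
    have "\<bar>LINT x|lborel. \<phi> (exp (- x)) * g x\<bar> \<le> e * (LINT x|lborel. \<bar>g x\<bar>)" if "e > 0" for e
    proof -
      obtain p where p: "real_polynomial_function p" and pe: "\<And>x. x \<in> {0..1} \<Longrightarrow> \<bar>\<phi> x - p x\<bar> < e"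
        using Stone_Weierstrass_real_polynomial_function[of "{0..1}" \<phi> e] \<open>e > 0\<close>
          continuous_on_subset[OF \<phi>] by (metis compact_Icc subset_UNIV)
      obtain a n where an: "p = (\<lambda>x. \<Sum>i\<le>n. a i * x ^ i)"
        using p by (auto simp: real_polynomial_function_iff_sum)
      have p_cont: "continuous_on UNIV p" unfolding an by (intro continuous_intros)
      have "integrable lborel (\<lambda>x. exp (- x) ^ i * g x)" for i :: nat
        by (rule weighted_int[of "\<lambda>y. y ^ i"]) (intro continuous_intros)
      then have "(LINT x|lborel. p (exp (- x)) * g x) = 0"
        by (simp add: an sum_distrib_right mult.assoc Bochner_Integration.integral_sum monom)
      then have "(LINT x|lborel. \<phi> (exp (- x)) * g x) = (LINT x|lborel. (\<phi> (exp (- x)) - p (exp (- x))) * g x)"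
        using weighted_int[OF \<phi>] weighted_int[OF p_cont] by (simp add: left_diff_distrib)
      also have "\<bar>\<dots>\<bar> \<le> (LINT x|lborel. e * \<bar>g x\<bar>)"
      proof (rule integral_abs_bound[THEN order_trans], rule integral_mono)
        show "integrable lborel (\<lambda>x. \<bar>(\<phi> (exp (- x)) - p (exp (- x))) * g x\<bar>)"
          using weighted_int[OF \<phi>] weighted_int[OF p_cont] by (auto simp add: left_diff_distrib)
        show "\<bar>(\<phi> (exp (- x)) - p (exp (- x))) * g x\<bar> \<le> e * \<bar>g x\<bar>" for x
        proof (cases "x > 0")
          case True
          then show ?thesis using pe[of "exp (- x)"] by (auto simp: abs_mult intro!: mult_right_mono)
        qed (simp add: g0)
      qed (use g_int in auto)
      finally show ?thesis by simp
    qed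
    then have "\<bar>LINT x|lborel. \<phi> (exp (- x)) * g x\<bar> \<le> 0"
      by (intro tendsto_lowerbound[of "\<lambda>e. e * (LINT x|lborel. \<bar>g x\<bar>)" 0 "at_right 0"])
         (auto intro!: tendsto_eq_intros simp: eventually_at_right_less eventually_at_topological
            intro: eventually_mono[OF eventually_at_right_less])
    then show ?thesis by simp
  qed
  have "(f \<longlongrightarrow> f t) (at_right t)"
    using rc[OF \<open>t \<ge> 0\<close>] by (simp add: continuous_within)
  then have "((\<lambda>x. f t * f x) \<longlongrightarrow> f t * f t) (at_right t)" by (intro tendsto_intros)
  moreover have "f t * f t > 0" using \<open>f t \<noteq> 0\<close> by (simp add: zero_less_mult_iff) linarith
  ultimately have "\<forall>\<^sub>F x in at_right t. f t * f x > 0"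
    by (rule order_tendstoD)
  then obtain b where "b > t" and pos: "\<And>x. t < x \<Longrightarrow> x < b \<Longrightarrow> f t * f x > 0"
    by (auto simp: eventually_at_right_field)
  \<comment> \<open>A bump in the variable \<open>exp (- x)\<close> that is positive exactly for \<open>t < x < b\<close>.\<close>
  define \<phi> where "\<phi> = (\<lambda>y. max 0 (min (y - exp (- b)) (exp (- t) - y)))"
  have \<phi>: "continuous_on UNIV \<phi>" unfolding \<phi>_def by (intro continuous_intros)
  have sgn: "f t * (\<phi> (exp (- x)) * g x) > 0" if "t < x" "x < b" for x
  proof -
    have "\<phi> (exp (- x)) > 0" using that by (auto simp: \<phi>_def)
    moreover have "f t * g x > 0" using pos[OF that] that \<open>t \<ge> 0\<close> by (simp add: g_def zero_less_mult_iff mult_less_0_iff)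
    ultimately show ?thesis by (simp add: zero_less_mult_iff mult_less_0_iff)
  qed
  have zero': "\<phi> (exp (- x)) = 0" if "x \<le> t \<or> b \<le> x" for x
  proof -
    have "min (exp (- x) - exp (- b)) (exp (- t) - exp (- x)) \<le> 0"
      using that by (auto simp: min_le_iff_disj)
    then show ?thesis by (simp add: \<phi>_def)
  qed
  have nonneg: "f t * (\<phi> (exp (- x)) * g x) \<ge> 0" for x
    using sgn[of x] zero'[of x] by (cases "t < x \<and> x < b") auto
  have "AE x in lborel. f t * (\<phi> (exp (- x)) * g x) = 0"
    using integral_nonneg_eq_0_iff_AE[of lborel "\<lambda>x. f t * (\<phi> (exp (- x)) * g x)"]
      weighted_int[OF \<phi>] cont[OF \<phi>] nonneg by auto
  then have "AE x in lborel. x \<notin> {t<..<b}"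
    by eventually_elim (use sgn in fastforce)
  then have "emeasure lborel {t<..<b} = 0"
    by (subst (asm) AE_iff_measurable[OF _ refl]) (auto simp: greaterThanLessThan_def greaterThan_def lessThan_def Int_def)
  with \<open>b > t\<close> show False by simp
qed

section \<open>Convolutions\<close>

lemma integrable_prod_mult:
  fixes f g :: "_ \<Rightarrow> real"
  assumes "sigma_finite_measure M1" "sigma_finite_measure M2"
    and f: "integrable M1 f" and g: "integrable M2 g"
  shows "integrable (M1 \<Otimes>\<^sub>M M2) (\<lambda>(x, y). f x * g y)"
proof -
  interpret pair_sigma_finite M1 M2 using assms by (simp add: pair_sigma_finite_def)
  have [measurable]: "f \<in> borel_measurable M1" "g \<in> borel_measurable M2" using f g by auto
  show ?thesis
  proof (rule Fubini_integrable)
    show "integrable M1 (\<lambda>x. LINT y|M2. norm (case (x, y) of (x, y) \<Rightarrow> f x * g y))"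
      using f by (simp add: abs_mult)
  qed (use g in auto)
qed

text \<open>
  Lebesgue measure on the plane is invariant under the shear \<open>(s, y) \<mapsto> (s - y, y)\<close>. This is
  the change of variables behind both statements about convolutions below.
\<close>

lemma shear_integral:
  fixes \<Phi> :: "real \<times> real \<Rightarrow> real"
  assumes \<Phi>: "integrable (lborel \<Otimes>\<^sub>M lborel) \<Phi>"
  shows "(LINT s|lborel. LINT y|lborel. \<Phi> (s - y, y)) = (LINT a|lborel. LINT y|lborel. \<Phi> (a, y))"
proof -
  have [measurable]: "\<Phi> \<in> borel_measurable (borel \<Otimes>\<^sub>M borel)"
    using \<Phi> by (auto dest: borel_measurable_integrable)
  have shift: "(LINT s|lborel. f (s - y)) = (LINT a|lborel. f a)" for f :: "real \<Rightarrow> real" and y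
    using lborel_integral_real_affine[of 1 f "- y"] by simp
  have swap: "integrable (lborel \<Otimes>\<^sub>M lborel) (\<lambda>(y, a). \<Phi> (a, y))"
    by (rule lborel_pair.integrable_product_swap[OF \<Phi>])
  have sheared: "integrable (lborel \<Otimes>\<^sub>M lborel) (\<lambda>(y, s). \<Phi> (s - y, y))"
  proof (rule lborel_pair.Fubini_integrable)
    show "(\<lambda>(y, s). \<Phi> (s - y, y)) \<in> borel_measurable (lborel \<Otimes>\<^sub>M lborel)" by measurable
    have "integrable lborel (\<lambda>y. LINT a|lborel. norm (\<Phi> (a, y)))"
      using lborel_pair.integrable_fst'[OF integrable_norm[OF swap]] by simp
    then show "integrable lborel (\<lambda>y. LINT s|lborel. norm (case (y, s) of (y, s) \<Rightarrow> \<Phi> (s - y, y)))"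
      using shift[of "\<lambda>a. \<bar>\<Phi> (a, y)\<bar>" y for y] by simp
    show "AE y in lborel. integrable lborel (\<lambda>s. case (y, s) of (y, s) \<Rightarrow> \<Phi> (s - y, y))"
      using lborel_pair.AE_integrable_fst'[OF swap]
    proof eventually_elim
      case (elim y)
      then show ?case using lborel_integrable_real_affine[of "\<lambda>a. \<Phi> (a, y)" 1 "- y"] by simp
    qed
  qed
  have "(LINT s|lborel. LINT y|lborel. \<Phi> (s - y, y)) = (LINT y|lborel. LINT s|lborel. \<Phi> (s - y, y))"
    using lborel_pair.Fubini_integral[OF sheared] by simp
  also have "\<dots> = (LINT y|lborel. LINT a|lborel. \<Phi> (a, y))"
    by (simp add: shift[of "\<lambda>a. \<Phi> (a, y)" y for y])
  also have "\<dots> = (LINT a|lborel. LINT y|lborel. \<Phi> (a, y))"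
    using lborel_pair.Fubini_integral[OF swap] by simp
  finally show ?thesis .
qed

lemma laplace_convolution:
  fixes f g :: "real \<Rightarrow> real"
  assumes f: "set_integrable lborel {0<..} (\<lambda>t. exp (- u * t) * f t)"
    and g: "set_integrable lborel {0<..} (\<lambda>t. exp (- u * t) * g t)"
  shows "(LINT t:{0<..}|lborel. exp (- u * t) * (LINT y:{0<..<t}|lborel. f (t - y) * g y)) =
    (LINT t:{0<..}|lborel. exp (- u * t) * f t) * (LINT t:{0<..}|lborel. exp (- u * t) * g t)"
proof -
  define F where "F = (\<lambda>t. indicator {0<..} t * (exp (- u * t) * f t))"
  define G where "G = (\<lambda>t. indicator {0<..} t * (exp (- u * t) * g t))"
  have FG: "integrable lborel F" "integrable lborel G"
    using f g by (simp_all add: F_def G_def set_integrable_def)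
  have "(LINT y|lborel. F (s - y) * G y) =
      indicator {0<..} s * (exp (- u * s) * (LINT y:{0<..<s}|lborel. f (s - y) * g y))" for s
  proof -
    have "F (s - y) * G y = indicator {0<..} s * exp (- u * s) * (indicator {0<..<s} y * (f (s - y) * g y))" for y
      by (auto simp: F_def G_def indicator_def exp_add[symmetric] algebra_simps)
    then show ?thesis by (simp add: set_lebesgue_integral_def mult.assoc)
  qed
  moreover have "(LINT s|lborel. LINT y|lborel. F (s - y) * G y) = (LINT a|lborel. F a) * (LINT y|lborel. G y)"
    using shear_integral[OF integrable_prod_mult[OF sigma_finite_lborel sigma_finite_lborel FG]] by simp
  ultimately show ?thesis
    by (simp add: set_lebesgue_integral_def F_def G_def)
qed

text \<open>
  Associativity of convolution, \<open>1 * (f * g) = f * (1 * g)\<close>, for functions that are integrable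
  on a bounded interval. It turns a convolution with a derivative into a convolution with the
  function itself.
\<close>

lemma integral_of_convolution:
  fixes f g :: "real \<Rightarrow> real"
  assumes f: "set_integrable lborel {0<..<T} f" and g: "set_integrable lborel {0<..<T} g"
  shows "(LINT s:{0<..<T}|lborel. LINT y:{0<..<s}|lborel. f (s - y) * g y) =
    (LINT a:{0<..<T}|lborel. f a * (LINT y:{0<..<T - a}|lborel. g y))"
proof -
  define F where "F = (\<lambda>t. indicator {0<..<T} t * f t)"
  define G where "G = (\<lambda>t. indicator {0<..<T} t * g t)"
  define \<Phi> where "\<Phi> = (\<lambda>(a, y). indicator {..<T} (a + y) * (F a * G y))"
  have FG: "integrable lborel F" "integrable lborel G"
    using f g by (simp_all add: F_def G_def set_integrable_def)
  then have [measurable]: "F \<in> borel_measurable borel" "G \<in> borel_measurable borel"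
    by (auto dest: borel_measurable_integrable)
  have "integrable (lborel \<Otimes>\<^sub>M lborel) \<Phi>"
  proof (rule Bochner_Integration.integrable_bound)
    show "integrable (lborel \<Otimes>\<^sub>M lborel) (\<lambda>(a, y). F a * G y)"
      using FG sigma_finite_lborel by (intro integrable_prod_mult)
    show "\<Phi> \<in> borel_measurable (lborel \<Otimes>\<^sub>M lborel)"
      unfolding \<Phi>_def by measurable
  qed (auto simp: \<Phi>_def indicator_def)
  note shear_integral[OF this]
  moreover have "(LINT y|lborel. \<Phi> (s - y, y)) =
      indicator {0<..<T} s * (LINT y:{0<..<s}|lborel. f (s - y) * g y)" for s
  proof -
    have "\<Phi> (s - y, y) = indicator {0<..<T} s * (indicator {0<..<s} y * (f (s - y) * g y))" for y
      by (auto simp: F_def G_def \<Phi>_def indicator_def)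
    then show ?thesis by (simp add: set_lebesgue_integral_def)
  qed
  moreover have "(LINT y|lborel. \<Phi> (a, y)) =
      indicator {0<..<T} a * (f a * (LINT y:{0<..<T - a}|lborel. g y))" for a
  proof -
    have "\<Phi> (a, y) = indicator {0<..<T} a * f a * (indicator {0<..<T - a} y * g y)" for y
      by (auto simp: F_def G_def \<Phi>_def indicator_def)
    then show ?thesis by (simp add: set_lebesgue_integral_def mult.assoc)
  qed
  ultimately show ?thesis
    by (simp add: set_lebesgue_integral_def)
qed

section \<open>The Prabhakar kernel and its Laplace transform\<close>

definition prabhakar_kernel :: "real \<Rightarrow> real \<Rightarrow> real \<Rightarrow> real \<Rightarrow> real \<Rightarrow> real" where
  "prabhakar_kernel \<gamma> \<mu> \<rho> \<phi> x =
     x powr (- \<mu>) * mittag_leffler3 (- \<gamma>) \<rho> (1 - \<mu>) (- \<phi> * x powr \<rho>)"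

text \<open>
  The Laplace exponent of the subordinated sum; divided by \<open>u\<close>, it is the Laplace transform of
  the Prabhakar kernel.
\<close>

definition levy_symbol :: "real \<Rightarrow> real \<Rightarrow> real \<Rightarrow> real \<Rightarrow> real \<Rightarrow> real" where
  "levy_symbol \<gamma> \<mu> \<rho> \<phi> u = u powr \<mu> * (1 + \<phi> * u powr (- \<rho>)) powr \<gamma>"

locale prabhakar =
  fixes \<gamma> \<mu> \<rho> \<phi> :: real
  assumes \<rho>_pos: "\<rho> > 0" and \<mu>_less: "\<mu> < 1" and \<mu>_pos: "\<mu> > 0" and \<phi>_pos: "\<phi> > 0"
begin

definition ml_coeff :: "nat \<Rightarrow> real" where
  "ml_coeff j = pochhammer (- \<gamma>) j / Gamma (\<rho> * real j + (1 - \<mu>)) / fact j"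

text \<open>
  The terms of the series of \<open>exp (- u x)\<close> times the kernel, cut off to \<open>x > 0\<close>.
\<close>

definition kernel_term :: "real \<Rightarrow> nat \<Rightarrow> real \<Rightarrow> real" where
  "kernel_term u j x = indicator {0<..} x * (ml_coeff j * (- \<phi>) ^ j * (x powr (\<rho> * real j - \<mu>) * exp (- u * x)))"

lemma mittag_leffler3_eq: "mittag_leffler3 (- \<gamma>) \<rho> (1 - \<mu>) z = (\<Sum>j. ml_coeff j * z ^ j)"
  by (simp add: mittag_leffler3_def ml_coeff_def)

lemma Gamma_pos: "Gamma (\<rho> * real j + (1 - \<mu>)) > 0"
  using \<rho>_pos \<mu>_less by (intro Gamma_real_pos) (simp add: add_nonneg_pos)

lemma kernel_term_eq:
  assumes "x > 0"
  shows "kernel_term u j x = x powr (- \<mu>) * exp (- u * x) * (ml_coeff j * (- \<phi> * x powr \<rho>) ^ j)"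
proof -
  have "x powr (\<rho> * real j - \<mu>) = x powr (- \<mu>) * (x powr \<rho>) ^ j"
    using assms by (simp add: powr_diff powr_minus powr_powr[symmetric] powr_realpow divide_inverse mult.commute)
  then show ?thesis
    using assms by (simp add: kernel_term_def power_mult_distrib[of "- \<phi>" "x powr \<rho>", simplified] mult_ac)
qed

text \<open>
  The gamma function from the Laplace transform of a power cancels the one in the
  denominator of the Mittag--Leffler coefficient. What remains is a term of the binomial series of
  \<open>(1 + \<phi> u\<^sup>-\<^sup>\<rho>)\<^sup>\<gamma>\<close>.
\<close>

lemma kernel_term_integral:
  assumes "u > 0"
  shows "has_bochner_integral lborel (kernel_term u j)
           (u powr (\<mu> - 1) * ((\<gamma> gchoose j) * (\<phi> * u powr (- \<rho>)) ^ j))"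
    and "has_bochner_integral lborel (\<lambda>x. norm (kernel_term u j x))
           (u powr (\<mu> - 1) * norm ((\<gamma> gchoose j) * (\<phi> * u powr (- \<rho>)) ^ j))"
proof -
  let ?I = "\<lambda>x. indicator {0<..} x * (x powr (\<rho> * real j - \<mu>) * exp (- u * x))"
  let ?c = "ml_coeff j * (- \<phi>) ^ j"
  let ?V = "Gamma (\<rho> * real j - \<mu> + 1) * u powr (- (\<rho> * real j - \<mu> + 1))"
  have gt: "\<rho> * real j - \<mu> > - 1" using \<rho>_pos \<mu>_less by (smt (verit) mult_nonneg_nonneg of_nat_0_le_iff)
  have int: "has_bochner_integral lborel ?I ?V"
    by (rule has_bochner_integral_powr_exp[OF gt assms])
  have G: "Gamma (\<rho> * real j - \<mu> + 1) > 0" using gt by (intro Gamma_real_pos) simp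
  have u: "u powr (- (\<rho> * real j - \<mu> + 1)) = u powr (\<mu> - 1) * (u powr (- \<rho>)) ^ j"
  proof -
    have "- (\<rho> * real j - \<mu> + 1) = (\<mu> - 1) + (- \<rho>) * real j" by simp
    then show ?thesis using assms by (simp only: powr_add powr_powr[symmetric]) (simp add: powr_realpow)
  qed
  have "ml_coeff j * Gamma (\<rho> * real j - \<mu> + 1) = pochhammer (- \<gamma>) j / fact j"
    using G by (simp add: ml_coeff_def add_diff_eq diff_add_eq)
  then have c: "ml_coeff j * (- \<phi>) ^ j * ?V = u powr (\<mu> - 1) * ((\<gamma> gchoose j) * (\<phi> * u powr (- \<rho>)) ^ j)"
    unfolding u gbinomial_pochhammer power_mult_distrib
    by (simp add: power_minus[of \<phi>] field_simps)
  have eq: "kernel_term u j = (\<lambda>x. ?c * ?I x)"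
    by (simp add: kernel_term_def fun_eq_iff)
  show "has_bochner_integral lborel (kernel_term u j)
           (u powr (\<mu> - 1) * ((\<gamma> gchoose j) * (\<phi> * u powr (- \<rho>)) ^ j))"
    unfolding eq c[symmetric] by (intro has_bochner_integral_mult_right int)
  have "has_bochner_integral lborel (\<lambda>x. \<bar>?c\<bar> * ?I x) (\<bar>?c\<bar> * ?V)"
    by (intro has_bochner_integral_mult_right int)
  moreover have "\<bar>?c\<bar> * ?I x = norm (kernel_term u j x)" for x
    by (simp add: kernel_term_def abs_mult indicator_def)
  moreover have "\<bar>?c\<bar> * ?V = \<bar>?c * ?V\<bar>" using G by (simp add: abs_mult)
  ultimately show "has_bochner_integral lborel (\<lambda>x. norm (kernel_term u j x))
           (u powr (\<mu> - 1) * norm ((\<gamma> gchoose j) * (\<phi> * u powr (- \<rho>)) ^ j))"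
    by (simp only: c) (simp add: abs_mult)
qed

lemma binomial_abs_summable:
  assumes "\<phi> * u powr (- \<rho>) < 1"
  shows "summable (\<lambda>j. norm ((\<gamma> gchoose j) * (\<phi> * u powr (- \<rho>)) ^ j))"
proof -
  \<comment> \<open>A power series converges absolutely strictly inside a point of convergence.\<close>
  obtain y where y: "\<phi> * u powr (- \<rho>) < y" "y < 1" using assms dense by blast
  have "0 \<le> \<phi> * u powr (- \<rho>)" using \<phi>_pos by simp
  with y gen_binomial_real[of y \<gamma>] show ?thesis
    by (intro powser_insidea[of _ y]) (auto simp: sums_iff)
qed

lemma kernel_terms_AE_summable:
  assumes "u > 0" and "\<phi> * u powr (- \<rho>) < 1"
  shows "AE x in lborel. summable (\<lambda>j. norm (kernel_term u j x))"
proof -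
  have int: "integrable lborel (kernel_term u j)" for j
    using kernel_term_integral(1)[OF assms(1)] by (rule integrable.intros)
  have [measurable]: "kernel_term u j \<in> borel_measurable borel" for j
    using int[of j] by (auto dest: borel_measurable_integrable)
  have nn: "(\<integral>\<^sup>+ x. ennreal (norm (kernel_term u j x)) \<partial>lborel) =
      ennreal (u powr (\<mu> - 1) * norm ((\<gamma> gchoose j) * (\<phi> * u powr (- \<rho>)) ^ j))" for j
    using kernel_term_integral(2)[OF assms(1), of j]
    by (subst nn_integral_eq_integral) (auto simp: has_bochner_integral_iff)
  have "(\<integral>\<^sup>+ x. (\<Sum>j. ennreal (norm (kernel_term u j x))) \<partial>lborel) =
      (\<Sum>j. ennreal (u powr (\<mu> - 1) * norm ((\<gamma> gchoose j) * (\<phi> * u powr (- \<rho>)) ^ j)))"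
    by (subst nn_integral_suminf) (simp_all add: nn del: real_norm_def)
  also have "\<dots> = ennreal (\<Sum>j. u powr (\<mu> - 1) * norm ((\<gamma> gchoose j) * (\<phi> * u powr (- \<rho>)) ^ j))"
    using binomial_abs_summable[OF assms(2)] by (intro suminf_ennreal2 summable_mult) auto
  also have "\<dots> \<noteq> \<infinity>" by simp
  finally have "AE x in lborel. (\<Sum>j. ennreal (norm (kernel_term u j x))) \<noteq> \<infinity>"
    by (intro nn_integral_PInf_AE) auto
  then show ?thesis
    by eventually_elim (auto intro!: summable_suminf_not_top)
qed

lemma laplace_threshold:
  obtains u0 where "u0 > 0" and "\<And>u. u \<ge> u0 \<Longrightarrow> \<phi> * u powr (- \<rho>) < 1"
proof
  define u0 where "u0 = (2 * \<phi>) powr (1 / \<rho>)"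
  show "u0 > 0" using \<phi>_pos by (simp add: u0_def)
  show "\<phi> * u powr (- \<rho>) < 1" if "u \<ge> u0" for u
  proof -
    have "u powr \<rho> \<ge> u0 powr \<rho>" using that \<open>u0 > 0\<close> \<rho>_pos by (intro powr_mono2) auto
    moreover have "u0 powr \<rho> = 2 * \<phi>" using \<phi>_pos \<rho>_pos by (simp add: u0_def powr_powr)
    ultimately have "u powr \<rho> > \<phi>" using \<phi>_pos by linarith
    then show ?thesis using \<phi>_pos by (simp add: powr_minus divide_inverse[symmetric] divide_less_eq)
  qed
qed

text \<open>
  The integrals of the absolute values of the terms have a finite sum, so by monotone convergence
  the series converges absolutely at almost every \<open>x\<close>, hence at arbitrarily large ones. For a
  power series this means absolute convergence everywhere.
\<close>

lemma ml_summable: "summable (\<lambda>j. norm (ml_coeff j * z ^ j))"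
proof -
  obtain u0 where u0: "u0 > 0" "\<phi> * u0 powr (- \<rho>) < 1" using laplace_threshold by blast
  \<comment> \<open>Chosen such that \<open>\<phi> x\<^sup>\<rho>\<close> exceeds \<open>\<bar>z\<bar>\<close> for all \<open>x > c\<close>.\<close>
  define c where "c = ((norm z + 1) / \<phi>) powr (1 / \<rho>)"
  have "c > 0" using \<phi>_pos by (simp add: c_def add_nonneg_eq_0_iff)
  have "\<exists>x>c. summable (\<lambda>j. norm (kernel_term u0 j x))"
  proof (rule ccontr)
    assume *: "\<not> ?thesis"
    have "AE x in lborel. x \<notin> {c<..<c + 1}"
      using kernel_terms_AE_summable[OF u0] by eventually_elim (use * in auto)
    then have "emeasure lborel {c<..<c + 1} = 0"
      by (subst (asm) AE_iff_measurable[OF _ refl]) (auto simp: greaterThanLessThan_def greaterThan_def lessThan_def Int_def)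
    then show False by simp
  qed
  then obtain x where x: "x > c" and sm: "summable (\<lambda>j. norm (kernel_term u0 j x))" by blast
  have "x > 0" using x \<open>c > 0\<close> by simp
  have "c powr \<rho> \<le> x powr \<rho>" using x \<open>c > 0\<close> \<rho>_pos by (intro powr_mono2) auto
  moreover have "c powr \<rho> = (norm z + 1) / \<phi>" using \<phi>_pos \<rho>_pos by (simp add: c_def powr_powr)
  ultimately have z: "norm z < norm (- \<phi> * x powr \<rho>)"
    using \<phi>_pos by (simp add: abs_mult field_simps)
  have "summable (\<lambda>j. x powr (- \<mu>) * exp (- u0 * x) * (ml_coeff j * (- \<phi> * x powr \<rho>) ^ j))"
    using summable_norm_cancel[OF sm] \<open>x > 0\<close> by (simp only: kernel_term_eq)
  then have "summable (\<lambda>j. ml_coeff j * (- \<phi> * x powr \<rho>) ^ j)"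
    by (rule summable_mult_D) (use \<open>x > 0\<close> in auto)
  then show ?thesis using z by (rule powser_insidea)
qed

lemma ml_cont: "continuous_on UNIV (\<lambda>z. mittag_leffler3 (- \<gamma>) \<rho> (1 - \<mu>) z)"
  unfolding mittag_leffler3_eq continuous_on_eq_continuous_at[OF open_UNIV]
  using isCont_powser_converges_everywhere[OF summable_norm_cancel[OF ml_summable]] by blast

abbreviation "K \<equiv> prabhakar_kernel \<gamma> \<mu> \<rho> \<phi>"

lemma kernel_measurable [measurable]: "K \<in> borel_measurable borel"
proof -
  have [measurable]: "(\<lambda>z. mittag_leffler3 (- \<gamma>) \<rho> (1 - \<mu>) z) \<in> borel_measurable borel"
    using ml_cont by (rule borel_measurable_continuous_onI)
  show ?thesis unfolding prabhakar_kernel_def[abs_def] by measurable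
qed

lemma kernel_laplace:
  assumes "u > 0" and "\<phi> * u powr (- \<rho>) < 1"
  shows "set_integrable lborel {0<..} (\<lambda>t. exp (- u * t) * K t)"
    and "(LINT t:{0<..}|lborel. exp (- u * t) * K t) = levy_symbol \<gamma> \<mu> \<rho> \<phi> u / u"
proof -
  have int: "integrable lborel (kernel_term u j)" for j
    using kernel_term_integral(1)[OF assms(1)] by (rule integrable.intros)
  have sm: "summable (\<lambda>j. LINT x|lborel. norm (kernel_term u j x))"
    unfolding has_bochner_integral_integral_eq[OF kernel_term_integral(2)[OF assms(1)]]
    by (intro summable_mult binomial_abs_summable assms)
  have eq: "(\<Sum>j. kernel_term u j x) = indicator {0<..} x *\<^sub>R (exp (- u * x) * K x)" for x
  proof (cases "x > 0")
    case True
    have "(\<Sum>j. kernel_term u j x) =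
        x powr (- \<mu>) * exp (- u * x) * (\<Sum>j. ml_coeff j * (- \<phi> * x powr \<rho>) ^ j)"
      unfolding kernel_term_eq[OF True]
      by (rule suminf_mult[OF summable_norm_cancel[OF ml_summable]])
    then show ?thesis using True by (simp add: prabhakar_kernel_def mittag_leffler3_eq)
  qed (simp add: kernel_term_def)
  show "set_integrable lborel {0<..} (\<lambda>t. exp (- u * t) * K t)"
    using integrable_suminf[OF int kernel_terms_AE_summable[OF assms] sm]
    unfolding set_integrable_def eq .
  have "(LINT t:{0<..}|lborel. exp (- u * t) * K t) = (\<Sum>j. LINT x|lborel. kernel_term u j x)"
    using integral_suminf[OF int kernel_terms_AE_summable[OF assms] sm]
    unfolding set_lebesgue_integral_def eq .
  also have "\<dots> = (\<Sum>j. u powr (\<mu> - 1) * ((\<gamma> gchoose j) * (\<phi> * u powr (- \<rho>)) ^ j))"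
    by (simp only: has_bochner_integral_integral_eq[OF kernel_term_integral(1)[OF assms(1)]])
  also have "\<dots> = u powr (\<mu> - 1) * (1 + \<phi> * u powr (- \<rho>)) powr \<gamma>"
    using gen_binomial_real[of "\<phi> * u powr (- \<rho>)" \<gamma>] assms \<phi>_pos
    by (subst suminf_mult) (auto simp: sums_iff)
  also have "\<dots> = levy_symbol \<gamma> \<mu> \<rho> \<phi> u / u"
    using assms by (simp add: levy_symbol_def powr_diff)
  finally show "(LINT t:{0<..}|lborel. exp (- u * t) * K t) = levy_symbol \<gamma> \<mu> \<rho> \<phi> u / u" .
qed

lemma kernel_locally_integrable: "set_integrable lborel {0<..<T} K"
proof -
  obtain u where u: "u > 0" "\<phi> * u powr (- \<rho>) < 1" using laplace_threshold by blast
  have "set_integrable lborel {0<..<T} (\<lambda>t. exp (- u * t) * K t)"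
    by (rule set_integrable_subset[OF kernel_laplace(1)[OF u]]) auto
  then have "integrable lborel (\<lambda>t. exp (u * T) * (indicator {0<..<T} t * (exp (- u * t) * K t)))"
    by (simp add: set_integrable_def)
  then show ?thesis
    unfolding set_integrable_def
  proof (rule Bochner_Integration.integrable_bound)
    show "AE t in lborel. norm (indicator {0<..<T} t *\<^sub>R K t)
        \<le> norm (exp (u * T) * (indicator {0<..<T} t * (exp (- u * t) * K t)))"
    proof (rule AE_I2)
      fix t
      have "1 * \<bar>K t\<bar> \<le> exp (u * T - u * t) * \<bar>K t\<bar>" if "t < T"
        using that u by (intro mult_right_mono) auto
      then show "norm (indicator {0<..<T} t *\<^sub>R K t)
        \<le> norm (exp (u * T) * (indicator {0<..<T} t * (exp (- u * t) * K t)))"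
        by (simp add: indicator_def abs_mult exp_diff exp_minus field_simps)
    qed
  qed measurable
qed

text \<open>
  Near \<open>0\<close> the kernel behaves like \<open>x\<^sup>-\<^sup>\<mu> / \<Gamma>(1 - \<mu>)\<close>.
\<close>

lemma kernel_pos_near_0:
  obtains c \<delta> where "c > 0" "\<delta> > 0" "\<And>x. 0 < x \<Longrightarrow> x < \<delta> \<Longrightarrow> K x \<ge> c"
proof -
  let ?m = "\<lambda>z. mittag_leffler3 (- \<gamma>) \<rho> (1 - \<mu>) z"
  have m0: "?m 0 > 0"
    using Gamma_pos[of 0] by (simp only: mittag_leffler3_eq powser_zero) (simp add: ml_coeff_def)
  have "isCont ?m 0" using ml_cont by (simp add: continuous_on_eq_continuous_at)
  moreover have "((\<lambda>x. - \<phi> * x powr \<rho>) \<longlongrightarrow> - \<phi> * 0) (at_right 0)"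
    using \<rho>_pos by (intro tendsto_intros)
      (auto intro!: tendsto_eq_intros tendsto_powr' intro: eventually_mono[OF eventually_at_right_less])
  ultimately have "((\<lambda>x. ?m (- \<phi> * x powr \<rho>)) \<longlongrightarrow> ?m 0) (at_right 0)"
    by (intro isCont_tendsto_compose[of 0 ?m]) auto
  then have "\<forall>\<^sub>F x in at_right 0. ?m (- \<phi> * x powr \<rho>) > ?m 0 / 2"
    using m0 by (intro order_tendstoD(1)) auto
  then obtain b where b: "b > 0" "\<And>x. 0 < x \<Longrightarrow> x < b \<Longrightarrow> ?m (- \<phi> * x powr \<rho>) > ?m 0 / 2"
    by (auto simp: eventually_at_right_field)
  show ?thesis
  proof (rule that[of "?m 0 / 2" "min b 1"])
    fix x assume x: "0 < x" "x < min b 1"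
    have "x powr (- \<mu>) \<ge> 1"
      using x \<mu>_pos by (simp add: powr_minus powr_le1 one_le_inverse)
    then have "x powr (- \<mu>) * ?m (- \<phi> * x powr \<rho>) \<ge> 1 * (?m 0 / 2)"
      using b(2)[of x] x m0 by (intro mult_mono) auto
    then show "K x \<ge> ?m 0 / 2" by (simp add: prabhakar_kernel_def)
  qed (use m0 b in auto)
qed

end

section \<open>The Cauchy problem in the Laplace domain\<close>

lemma measurable_continuous_halfline:
  fixes g :: "real \<Rightarrow> real"
  assumes "continuous_on {0..} g"
  shows "(\<lambda>t. indicator {0<..} t * g t) \<in> borel_measurable borel"
proof -
  have "continuous_on {0<..} g" by (rule continuous_on_subset[OF assms]) auto
  from borel_measurable_continuous_on_indicator[OF _ this] show ?thesis by simp
qed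

lemma integrable_exp_bounded:
  fixes f :: "real \<Rightarrow> real"
  assumes "u > 0" and [measurable]: "(\<lambda>t. indicator {0<..} t * f t) \<in> borel_measurable borel"
    and "\<And>t. t > 0 \<Longrightarrow> \<bar>f t\<bar> \<le> B"
  shows "set_integrable lborel {0<..} (\<lambda>t. exp (- u * t) * f t)"
proof -
  have "integrable lborel (\<lambda>t. B * (indicator {0<..} t * exp (- u * t)))"
    using integrable_I0i_exp_mscale[OF \<open>u > 0\<close>] by (simp add: set_integrable_def mult.commute)
  then show ?thesis
    unfolding set_integrable_def
  proof (rule Bochner_Integration.integrable_bound)
    have "(\<lambda>t. exp (- u * t) * (indicator {0<..} t * f t)) \<in> borel_measurable borel" by measurable
    then show "(\<lambda>t. indicator {0<..} t *\<^sub>R (exp (- u * t) * f t)) \<in> borel_measurable lborel"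
      by (simp add: mult_ac)
    show "AE t in lborel. norm (indicator {0<..} t *\<^sub>R (exp (- u * t) * f t))
        \<le> norm (B * (indicator {0<..} t * exp (- u * t)))"
    proof (rule AE_I2)
      fix t
      show "norm (indicator {0<..} t *\<^sub>R (exp (- u * t) * f t))
        \<le> norm (B * (indicator {0<..} t * exp (- u * t)))"
        using assms(3)[of t] by (auto simp: indicator_def abs_mult mult.commute intro!: mult_left_mono)
    qed
  qed
qed

lemma laplace_one:
  fixes u :: real
  assumes "u > 0"
  shows "(LINT t:{0<..}|lborel. exp (- u * t)) = 1 / u"
proof -
  have "(LINT t:{0<..}|lborel. exp (- u * t)) =
      (LINT x|lborel. indicator {0<..} x * (x powr 0 * exp (- u * x)))"
    unfolding set_lebesgue_integral_def by (intro Bochner_Integration.integral_cong) (auto simp: indicator_def)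
  then show ?thesis
    using has_bochner_integral_powr_exp[of 0 u] assms
    by (simp add: has_bochner_integral_iff powr_minus divide_inverse)
qed

lemma integral_of_derivative:
  fixes f f' :: "real \<Rightarrow> real"
  assumes "t \<ge> 0" and cont: "continuous_on {0..t} f"
    and deriv: "\<And>x. 0 < x \<Longrightarrow> x < t \<Longrightarrow> (f has_real_derivative f' x) (at x)"
    and int: "set_integrable lborel {0<..<t} f'"
  shows "(LINT x:{0<..<t}|lborel. f' x) = f t - f 0"
proof -
  have "(f' has_integral (f t - f 0)) {0..t}"
    using assms(1) cont deriv
    by (intro fundamental_theorem_of_calculus_interior)
      (auto simp: has_real_derivative_iff_has_vector_derivative[symmetric])
  then have "(f' has_integral (f t - f 0)) {0<..<t}" by (simp add: has_integral_Icc_iff_Ioo)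
  then show ?thesis using set_borel_integral_eq_integral(2)[OF int] by (simp add: integral_unique)
qed

context prabhakar
begin

lemma caputo_prabhakar_integrand_eq:
  "caputo_prabhakar_integrand \<gamma> \<mu> \<rho> (- \<phi>) f t y = K (t - y) * deriv f y"
  by (simp add: caputo_prabhakar_integrand_def prabhakar_kernel_def)

text \<open>
  Since the kernel is bounded below near \<open>0\<close>, the integrability of \<open>K (t - y) f'(y)\<close>
  up to time \<open>t\<close> yields that of \<open>f'\<close> on a window of fixed length before \<open>t\<close>.
  Overlapping windows cover every bounded interval.
\<close>

lemma deriv_locally_integrable:
  assumes int: "\<And>t. t > 0 \<Longrightarrow>
      set_integrable lborel {0<..<t} (caputo_prabhakar_integrand \<gamma> \<mu> \<rho> (- \<phi>) f t)"
  shows "set_integrable lborel {0<..<T} (deriv f)"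
proof -
  obtain c \<delta> where c: "c > 0" and \<delta>: "\<delta> > 0" and K: "\<And>x. 0 < x \<Longrightarrow> x < \<delta> \<Longrightarrow> K x \<ge> c"
    using kernel_pos_near_0 by blast
  have window: "set_integrable lborel {max 0 (t - \<delta>)<..<t} (deriv f)" if "t > 0" for t
  proof -
    let ?J = "{max 0 (t - \<delta>)<..<t}"
    define h where "h = (\<lambda>y. indicator {0<..<t} y * (K (t - y) * deriv f y))"
    have h: "integrable lborel h"
      using int[OF that] by (simp add: set_integrable_def caputo_prabhakar_integrand_eq h_def)
    have [measurable]: "h \<in> borel_measurable borel"
      using borel_measurable_integrable[OF h] by simp
    have eq: "indicator ?J y *\<^sub>R deriv f y = indicator ?J y * (h y / K (t - y))" for y
      using K[of "t - y"] c by (auto simp: indicator_def h_def)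
    show ?thesis
      unfolding set_integrable_def eq
    proof (rule Bochner_Integration.integrable_bound)
      show "integrable lborel (\<lambda>y. h y / c)" using h by simp
      show "(\<lambda>y. indicator ?J y * (h y / K (t - y))) \<in> borel_measurable lborel" by measurable
      show "AE y in lborel. norm (indicator ?J y * (h y / K (t - y))) \<le> norm (h y / c)"
      proof (rule AE_I2)
        fix y
        show "norm (indicator ?J y * (h y / K (t - y))) \<le> norm (h y / c)"
        proof (cases "y \<in> ?J")
          case True
          then have "K (t - y) \<ge> c" using K[of "t - y"] by auto
          then have "\<bar>h y\<bar> / \<bar>K (t - y)\<bar> \<le> \<bar>h y\<bar> / c" using c by (intro divide_left_mono) auto
          then show ?thesis using True c by simp
        qed (use c in simp)
      qed
    qed
  qed
  \<comment> \<open>Steps of half the window length make consecutive windows overlap.\<close>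
  have "set_integrable lborel {0<..<real n * (\<delta> / 2)} (deriv f)" for n
  proof (induction n)
    case (Suc n)
    have "set_integrable lborel ({0<..<real n * (\<delta> / 2)} \<union>
        {max 0 (real (Suc n) * (\<delta> / 2) - \<delta>)<..<real (Suc n) * (\<delta> / 2)}) (deriv f)"
      using Suc window \<delta> by (intro set_integrable_Un) auto
    then show ?case
    proof (rule set_integrable_subset)
      show "{0<..<real (Suc n) * (\<delta> / 2)} \<subseteq> {0<..<real n * (\<delta> / 2)} \<union>
        {max 0 (real (Suc n) * (\<delta> / 2) - \<delta>)<..<real (Suc n) * (\<delta> / 2)}"
        using \<delta> by (auto simp: algebra_simps)
    qed simp
  qed (simp add: set_integrable_def)
  moreover obtain n where "T / (\<delta> / 2) < real n" using reals_Archimedean2 by blast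
  ultimately have "set_integrable lborel {0<..<real n * (\<delta> / 2)} (deriv f)" and "T < real n * (\<delta> / 2)"
    using \<delta> by (simp_all only: pos_divide_less_eq half_gt_zero)
  then show ?thesis by (elim set_integrable_subset) auto
qed

text \<open>
  With \<open>K\<close> the kernel, the equation \<open>K * f' = r\<close> becomes
  \<open>K * (f - f(0)) = 1 * r\<close> after integration. All functions in it are bounded or have an
  exponentially weighted integral, so the Laplace transform can be applied.
\<close>

lemma laplace_caputo_prabhakar_equation:
  fixes f r :: "real \<Rightarrow> real"
  assumes u: "u > 0" "\<phi> * u powr (- \<rho>) < 1"
    and f: "continuous_on {0..} f" "\<And>t. t > 0 \<Longrightarrow> f differentiable at t" "\<And>t. t \<ge> 0 \<Longrightarrow> \<bar>f t\<bar> \<le> B"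
    and r: "continuous_on {0..} r" "\<And>t. t \<ge> 0 \<Longrightarrow> \<bar>r t\<bar> \<le> B'"
    and int: "\<And>t. t > 0 \<Longrightarrow>
      set_integrable lborel {0<..<t} (caputo_prabhakar_integrand \<gamma> \<mu> \<rho> (- \<phi>) f t)"
    and eq: "\<And>t. t > 0 \<Longrightarrow> caputo_prabhakar \<gamma> \<mu> \<rho> (- \<phi>) f t = r t"
  shows "levy_symbol \<gamma> \<mu> \<rho> \<phi> u * ((LINT t:{0<..}|lborel. exp (- u * t) * f t) - f 0 / u) =
    (LINT t:{0<..}|lborel. exp (- u * t) * r t)"
proof -
  have D: "set_integrable lborel {0<..<T} (deriv f)" for T
    by (rule deriv_locally_integrable[OF int])
  have fint: "set_integrable lborel {0<..} (\<lambda>t. exp (- u * t) * f t)"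
    using f(3) by (intro integrable_exp_bounded[OF u(1) measurable_continuous_halfline[OF f(1)], of B]) auto
  have rint: "set_integrable lborel {0<..} (\<lambda>t. exp (- u * t) * r t)"
    using r by (intro integrable_exp_bounded[OF u(1) measurable_continuous_halfline[OF r(1)], of B']) auto
  have cint: "set_integrable lborel {0<..} (\<lambda>t. exp (- u * t) * c)" for c :: real
    by (intro integrable_exp_bounded[OF u(1), of _ "\<bar>c\<bar>"]) auto
  have dint: "set_integrable lborel {0<..} (\<lambda>t. exp (- u * t) * (f t - f 0))"
    using set_integral_diff(1)[OF fint cint[of "f 0"]] by (simp add: right_diff_distrib)
  have FTC: "(LINT y:{0<..<t}|lborel. deriv f y) = f t - f 0" if "t \<ge> 0" for t
    using f(1,2) D[of t] that
    by (intro integral_of_derivative)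
      (auto simp: DERIV_deriv_iff_real_differentiable intro: continuous_on_subset)
  have "(LINT y:{0<..<t}|lborel. (f (t - y) - f 0) * K y) = (LINT y:{0<..<t}|lborel. 1 * r y)"
    if "t > 0" for t
  proof -
    have "(LINT y:{0<..<t}|lborel. 1 * r y) =
        (LINT s:{0<..<t}|lborel. LINT y:{0<..<s}|lborel. K (s - y) * deriv f y)"
      using eq by (intro set_lebesgue_integral_cong)
        (auto simp: caputo_prabhakar_def caputo_prabhakar_integrand_eq)
    also have "\<dots> = (LINT a:{0<..<t}|lborel. K a * (LINT y:{0<..<t - a}|lborel. deriv f y))"
      by (rule integral_of_convolution[OF kernel_locally_integrable D])
    also have "\<dots> = (LINT y:{0<..<t}|lborel. (f (t - y) - f 0) * K y)"
      by (intro set_lebesgue_integral_cong) (auto simp: FTC)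
    finally show ?thesis by simp
  qed
  then have "(LINT t:{0<..}|lborel. exp (- u * t) * (LINT y:{0<..<t}|lborel. (f (t - y) - f 0) * K y)) =
      (LINT t:{0<..}|lborel. exp (- u * t) * (LINT y:{0<..<t}|lborel. 1 * r y))"
    by (intro set_lebesgue_integral_cong) auto
  then have int_eq: "(LINT t:{0<..}|lborel. exp (- u * t) * (f t - f 0)) * (levy_symbol \<gamma> \<mu> \<rho> \<phi> u / u) =
      (1 / u) * (LINT t:{0<..}|lborel. exp (- u * t) * r t)"
    using laplace_convolution[OF dint kernel_laplace(1)[OF u]] laplace_convolution[of u "\<lambda>_. 1" r]
      cint[of 1] rint laplace_one[OF u(1)] kernel_laplace(2)[OF u] by simp
  have f_eq: "(LINT t:{0<..}|lborel. exp (- u * t) * (f t - f 0)) =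
      (LINT t:{0<..}|lborel. exp (- u * t) * f t) - f 0 / u"
    using set_integral_diff(2)[OF fint cint[of "f 0"]] laplace_one[OF u(1)]
    by (simp add: right_diff_distrib)
  have solve: "b * a = c" if "a * (b / u) = 1 / u * c" for a b c
  proof -
    have "b * a = u * (a * (b / u))" using u by simp
    also have "\<dots> = c" unfolding that using u by simp
    finally show ?thesis .
  qed
  show ?thesis using int_eq unfolding f_eq by (rule solve)
qed

lemma levy_symbol_pos: "u > 0 \<Longrightarrow> levy_symbol \<gamma> \<mu> \<rho> \<phi> u > 0"
  using \<phi>_pos add_pos_nonneg[of 1 "\<phi> * u powr (- \<rho>)"] by (simp add: levy_symbol_def)

text \<open>
  In the Laplace domain the Cauchy problem reads
  \<open>\<psi> (L\<^sub>k - p\<^sub>k(0) / u) = \<Lambda> (L\<^sub>k\<^sub>-\<^sub>1 - L\<^sub>k)\<close>, which determines all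
  \<open>L\<^sub>k\<close> one after the other.
\<close>

lemma laplace_state_probabilities:
  fixes p :: "nat \<Rightarrow> real \<Rightarrow> real"
  assumes u: "u > 0" "\<phi> * u powr (- \<rho>) < 1" and "\<Lambda> > 0"
    and init: "\<And>k. p k 0 = (if k = 0 then 1 else 0)"
    and cont: "\<And>k. continuous_on {0..} (p k)"
    and diff: "\<And>k t. t > 0 \<Longrightarrow> p k differentiable at t"
    and bound: "\<And>k t. t \<ge> 0 \<Longrightarrow> \<bar>p k t\<bar> \<le> 1"
    and int: "\<And>k t. t > 0 \<Longrightarrow>
      set_integrable lborel {0<..<t} (caputo_prabhakar_integrand \<gamma> \<mu> \<rho> (- \<phi>) (p k) t)"
    and eq: "\<And>k t. t > 0 \<Longrightarrow> caputo_prabhakar \<gamma> \<mu> \<rho> (- \<phi>) (p k) t =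
      - \<Lambda> * p k t + \<Lambda> * (if k = 0 then 0 else p (k - 1) t)"
  shows "(LINT t:{0<..}|lborel. exp (- u * t) * p k t) =
    levy_symbol \<gamma> \<mu> \<rho> \<phi> u * \<Lambda> ^ k / (u * (levy_symbol \<gamma> \<mu> \<rho> \<phi> u + \<Lambda>) ^ (k + 1))"
proof -
  let ?\<psi> = "levy_symbol \<gamma> \<mu> \<rho> \<phi> u"
  define L where "L k = (LINT t:{0<..}|lborel. exp (- u * t) * p k t)" for k
  have \<psi>: "?\<psi> > 0" by (rule levy_symbol_pos[OF u(1)])
  have pint: "set_integrable lborel {0<..} (\<lambda>t. exp (- u * t) * p k t)" for k
    by (rule integrable_exp_bounded[OF u(1) measurable_continuous_halfline[OF cont], where B = 1]) (use bound in auto)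
  have rec: "?\<psi> * (L k - p k 0 / u) = - \<Lambda> * L k + \<Lambda> * (if k = 0 then 0 else L (k - 1))" for k
  proof -
    let ?q = "\<lambda>t. if k = 0 then 0 else p (k - 1) t"
    have "\<bar>- \<Lambda> * p k t + \<Lambda> * ?q t\<bar> \<le> 2 * \<Lambda>" if "t \<ge> 0" for t
    proof -
      have "\<bar>- \<Lambda> * p k t + \<Lambda> * ?q t\<bar> \<le> \<bar>\<Lambda> * p k t\<bar> + \<bar>\<Lambda> * ?q t\<bar>" by linarith
      also have "\<dots> \<le> \<Lambda> * 1 + \<Lambda> * 1"
        using bound[OF that] \<open>\<Lambda> > 0\<close>
        by (intro add_mono) (auto simp: abs_mult)
      finally show ?thesis by simp
    qed
    moreover have "continuous_on {0..} (\<lambda>t. - \<Lambda> * p k t + \<Lambda> * ?q t)"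
      using cont by (cases "k = 0") (auto intro!: continuous_intros)
    ultimately have "?\<psi> * (L k - p k 0 / u) = (LINT t:{0<..}|lborel. exp (- u * t) * (- \<Lambda> * p k t + \<Lambda> * ?q t))"
      unfolding L_def by (intro laplace_caputo_prabhakar_equation[OF u cont diff bound _ _ int eq])
    also have "\<dots> = (LINT t:{0<..}|lborel. \<Lambda> * (exp (- u * t) * ?q t) - \<Lambda> * (exp (- u * t) * p k t))"
      by (simp add: algebra_simps)
    also have "\<dots> = (LINT t:{0<..}|lborel. \<Lambda> * (exp (- u * t) * ?q t)) -
        (LINT t:{0<..}|lborel. \<Lambda> * (exp (- u * t) * p k t))"
    proof (rule set_integral_diff(2))
      have "set_integrable lborel {0<..} (\<lambda>t. exp (- u * t) * ?q t)"
        using pint by (cases "k = 0") (auto simp: set_integrable_def)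
      then show "set_integrable lborel {0<..} (\<lambda>t. \<Lambda> * (exp (- u * t) * ?q t))"
        by (intro set_integrable_mult_right)
      show "set_integrable lborel {0<..} (\<lambda>t. \<Lambda> * (exp (- u * t) * p k t))"
        using pint by (intro set_integrable_mult_right)
    qed
    also have "\<dots> = \<Lambda> * (LINT t:{0<..}|lborel. exp (- u * t) * ?q t) - \<Lambda> * L k"
      by (simp only: set_integral_mult_right L_def)
    finally show ?thesis by (cases "k = 0") (simp_all add: L_def)
  qed
  have "L k = ?\<psi> * \<Lambda> ^ k / (u * (?\<psi> + \<Lambda>) ^ (k + 1))"
  proof (induction k)
    case 0
    have "(?\<psi> + \<Lambda>) * L 0 = ?\<psi> / u" using rec[of 0] by (simp add: init algebra_simps)
    moreover have "?\<psi> + \<Lambda> \<noteq> 0" using \<psi> \<open>\<Lambda> > 0\<close> by simp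
    ultimately have "L 0 = ?\<psi> / u / (?\<psi> + \<Lambda>)"
      by (metis mult.commute nonzero_eq_divide_eq)
    then show ?case by simp
  next
    case (Suc k)
    have "(?\<psi> + \<Lambda>) * L (Suc k) = \<Lambda> * L k" using rec[of "Suc k"] by (simp add: init algebra_simps)
    then have "L (Suc k) = \<Lambda> * L k / (?\<psi> + \<Lambda>)" using \<psi> \<open>\<Lambda> > 0\<close> by (simp add: field_simps)
    then show ?case by (simp add: Suc mult_ac)
  qed
  then show ?thesis by (simp add: L_def)
qed

end

section \<open>Processes at an independent random time\<close>

text \<open>
  The points \<open>grid_above m (grid_index m x)\<close> lie strictly above \<open>x\<close> and converge to it, as
  is needed to approximate a right-continuous process at a random time by its values at countably
  many fixed times.
\<close>

definition grid_above :: "nat \<Rightarrow> nat \<Rightarrow> real" where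
  "grid_above m j = (real j + 1) / (real m + 1)"

definition grid_index :: "nat \<Rightarrow> real \<Rightarrow> nat" where
  "grid_index m x = nat \<lfloor>(real m + 1) * x\<rfloor>"

lemma grid_index_measurable [measurable]: "grid_index m \<in> measurable borel (count_space UNIV)"
  unfolding grid_index_def[abs_def] by measurable

lemma grid_above_nonneg: "grid_above m j \<ge> 0"
  by (simp add: grid_above_def)

lemma grid_above_tendsto:
  assumes "x \<ge> 0"
  shows "filterlim (\<lambda>m. grid_above m (grid_index m x)) (at_right x) sequentially"
proof -
  have gt: "grid_above m (grid_index m x) > x" and le: "grid_above m (grid_index m x) \<le> x + 1 / (real m + 1)" for m
  proof -
    have "real (grid_index m x) = of_int \<lfloor>(real m + 1) * x\<rfloor>"
      using assms by (simp add: grid_index_def)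
    then have "(real m + 1) * x < real (grid_index m x) + 1" "real (grid_index m x) \<le> (real m + 1) * x"
      by linarith+
    then have "(real m + 1) * x / (real m + 1) < grid_above m (grid_index m x)"
      "grid_above m (grid_index m x) \<le> ((real m + 1) * x + 1) / (real m + 1)"
      unfolding grid_above_def by (intro divide_strict_right_mono divide_right_mono; simp)+
    then show "grid_above m (grid_index m x) > x" "grid_above m (grid_index m x) \<le> x + 1 / (real m + 1)"
      by (simp_all add: add_divide_distrib)
  qed
  have "(\<lambda>m. 1 / (real m + 1)) \<longlonglongrightarrow> 0"
    using LIMSEQ_inverse_real_of_nat by (simp add: inverse_eq_divide add.commute)
  then have "(\<lambda>m. x + 1 / (real m + 1)) \<longlonglongrightarrow> x + 0" by (intro tendsto_intros)
  then have "(\<lambda>m. grid_above m (grid_index m x)) \<longlonglongrightarrow> x"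
    using tendsto_sandwich[of "\<lambda>_. x" "\<lambda>m. grid_above m (grid_index m x)" sequentially "\<lambda>m. x + 1 / (real m + 1)" x]
      gt le by (simp add: less_imp_le)
  moreover have "grid_above m (grid_index m x) \<noteq> x" for m using gt[of m] by simp
  ultimately show ?thesis using gt by (simp add: filterlim_at)
qed

lemma (in complete_measure) borel_measurable_AE_eq:
  fixes f g :: "'a \<Rightarrow> real"
  assumes f: "f \<in> borel_measurable M" and ae: "AE x in M. f x = g x"
  shows "g \<in> borel_measurable M"
proof (rule measurableI)
  fix A :: "real set" assume A: "A \<in> sets borel"
  show "g -` A \<inter> space M \<in> sets M"
  proof (rule in_sets_AE)
    show "AE x in M. x \<in> f -` A \<inter> space M \<longleftrightarrow> x \<in> g -` A \<inter> space M"
      using ae by eventually_elim auto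
    show "f -` A \<inter> space M \<in> sets M" using f A by (rule measurable_sets)
  qed auto
qed simp

text \<open>
  The index \<open>J\<close> can take infinitely many values, so the decomposition according to its value
  is made on \<open>J < N\<close> first, and \<open>N\<close> then tends to infinity.
\<close>

lemma (in prob_space) expectation_at_countable_time:
  fixes Y :: "real \<Rightarrow> 'a \<Rightarrow> real" and J :: "'a \<Rightarrow> nat" and q :: "nat \<Rightarrow> real"
  assumes meas: "\<And>i. Y (q i) \<in> borel_measurable M"
    and J [measurable]: "J \<in> measurable M (count_space UNIV)"
    and bound: "AE \<omega> in M. \<forall>i. \<bar>Y (q i) \<omega>\<bar> \<le> 1"
    and H: "\<And>i. \<bar>H (q i)\<bar> \<le> 1"
    and indep: "\<And>i. (LINT \<omega>|M. indicator {i} (J \<omega>) * Y (q i) \<omega>) =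
      (LINT \<omega>|M. indicator {i} (J \<omega>)) * H (q i)"
  shows "expectation (\<lambda>\<omega>. Y (q (J \<omega>)) \<omega>) = expectation (\<lambda>\<omega>. H (q (J \<omega>)))"
proof -
  note [measurable] = meas
  have [measurable]: "(\<lambda>\<omega>. indicator S (J \<omega>) :: real) \<in> borel_measurable M" for S
    by (rule measurable_compose[OF J]) simp
  have Z [measurable]: "(\<lambda>\<omega>. Y (q (J \<omega>)) \<omega>) \<in> borel_measurable M"
    by (rule measurable_compose_countable[OF meas J])
  have H_meas [measurable]: "(\<lambda>\<omega>. H (q (J \<omega>))) \<in> borel_measurable M"
    by (rule measurable_compose_countable[OF _ J]) auto
  have cut: "(\<lambda>N. expectation (\<lambda>\<omega>. indicator {..<N} (J \<omega>) * Z \<omega>)) \<longlonglongrightarrow> expectation Z"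
    if [measurable]: "Z \<in> borel_measurable M" and Z: "AE \<omega> in M. \<bar>Z \<omega>\<bar> \<le> 1" for Z :: "'a \<Rightarrow> real"
  proof (rule integral_dominated_convergence[where w = "\<lambda>_. 1"])
    show "AE \<omega> in M. (\<lambda>N. indicator {..<N} (J \<omega>) * Z \<omega>) \<longlonglongrightarrow> Z \<omega>"
    proof (rule AE_I2, rule tendsto_eventually)
      fix \<omega>
      show "\<forall>\<^sub>F N in sequentially. indicator {..<N} (J \<omega>) * Z \<omega> = Z \<omega>"
        using eventually_gt_at_top[of "J \<omega>"] by eventually_elim simp
    qed
    show "AE \<omega> in M. norm (indicator {..<N} (J \<omega>) * Z \<omega>) \<le> 1" for N
      using Z by eventually_elim (simp add: indicator_def)
  qed auto
  have "expectation (\<lambda>\<omega>. indicator {..<N} (J \<omega>) * Y (q (J \<omega>)) \<omega>) =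
      expectation (\<lambda>\<omega>. indicator {..<N} (J \<omega>) * H (q (J \<omega>)))" for N
  proof -
    have decompose: "indicator {..<N} (J \<omega>) * z (J \<omega>) = (\<Sum>i<N. indicator {i} (J \<omega>) * z i)" for z :: "nat \<Rightarrow> real" and \<omega>
    proof -
      have "(\<Sum>i<N. indicator {i} (J \<omega>) * z i) = (\<Sum>i<N. if i = J \<omega> then z i else 0)"
        by (intro sum.cong) (auto simp: indicator_def)
      then show ?thesis by (simp add: indicator_def)
    qed
    have int: "integrable M (\<lambda>\<omega>. indicator {i} (J \<omega>) * Y (q i) \<omega>)" for i
    proof (rule integrable_const_bound[of _ 1])
      show "AE \<omega> in M. norm (indicator {i} (J \<omega>) * Y (q i) \<omega>) \<le> 1"
        using bound by eventually_elim (auto simp: indicator_def)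
    qed simp
    have int': "integrable M (\<lambda>\<omega>. indicator {i} (J \<omega>) * H (q i))" for i
      by (rule integrable_const_bound[of _ 1]) (use H in \<open>auto simp: indicator_def\<close>)
    show ?thesis
      unfolding decompose[of _ "\<lambda>j. Y (q j) \<omega>" for \<omega>] decompose[of _ "\<lambda>j. H (q j)"]
      unfolding Bochner_Integration.integral_sum[OF int] Bochner_Integration.integral_sum[OF int'] indep
      by (simp only: integral_mult_left_zero)
  qed
  moreover have "AE \<omega> in M. \<bar>Y (q (J \<omega>)) \<omega>\<bar> \<le> 1" using bound by eventually_elim auto
  ultimately show ?thesis
    using cut[OF Z] cut[OF H_meas] H LIMSEQ_unique by auto
qed

text \<open>
  The factorisation for each fixed time passes to a random time that takes values in a grid, and from
  there, by right-continuity and dominated convergence, to \<open>\<tau>\<close>. The resulting random variable is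
  only almost surely a limit of measurable ones; completeness of the measure makes it measurable.
\<close>

lemma (in prob_space) expectation_at_independent_time:
  fixes Y :: "real \<Rightarrow> 'a \<Rightarrow> real" and \<tau> :: "'a \<Rightarrow> real" and H :: "real \<Rightarrow> real"
  assumes complete: "complete_measure M"
    and meas: "\<And>t. t \<ge> 0 \<Longrightarrow> Y t \<in> borel_measurable M"
    and \<tau> [measurable]: "\<tau> \<in> borel_measurable M" and \<tau>_nonneg: "AE \<omega> in M. \<tau> \<omega> \<ge> 0"
    and rc: "AE \<omega> in M. \<forall>t\<ge>0. continuous (at_right t) (\<lambda>t. Y t \<omega>)"
    and bound: "AE \<omega> in M. \<forall>t\<ge>0. \<bar>Y t \<omega>\<bar> \<le> 1"
    and H: "continuous_on UNIV H" "\<And>t. t \<ge> 0 \<Longrightarrow> \<bar>H t\<bar> \<le> 1"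
    and indep: "\<And>t A. t \<ge> 0 \<Longrightarrow> A \<in> sets borel \<Longrightarrow>
      (LINT \<omega>|M. indicator A (\<tau> \<omega>) * Y t \<omega>) = (LINT \<omega>|M. indicator A (\<tau> \<omega>)) * H t"
  shows "(\<lambda>\<omega>. Y (\<tau> \<omega>) \<omega>) \<in> borel_measurable M \<and>
    expectation (\<lambda>\<omega>. Y (\<tau> \<omega>) \<omega>) = expectation (\<lambda>\<omega>. H (\<tau> \<omega>))"
proof -
  interpret complete_measure M by (rule complete)
  define Z where "Z m \<omega> = Y (grid_above m (grid_index m (\<tau> \<omega>))) \<omega>" for m \<omega>
  have Z_meas [measurable]: "Z m \<in> borel_measurable M" for m
    unfolding Z_def[abs_def] by (rule measurable_compose_countable[OF meas]) (auto intro: grid_above_nonneg)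
  have Z_lim: "AE \<omega> in M. (\<lambda>m. Z m \<omega>) \<longlonglongrightarrow> Y (\<tau> \<omega>) \<omega>"
    using rc \<tau>_nonneg
  proof eventually_elim
    case (elim \<omega>)
    then have "((\<lambda>t. Y t \<omega>) \<longlongrightarrow> Y (\<tau> \<omega>) \<omega>) (at_right (\<tau> \<omega>))"
      by (simp add: continuous_within)
    from filterlim_compose[OF this grid_above_tendsto] elim show ?case by (simp add: Z_def)
  qed
  have "(\<lambda>\<omega>. lim (\<lambda>m. Z m \<omega>)) \<in> borel_measurable M" by measurable
  moreover have "AE \<omega> in M. lim (\<lambda>m. Z m \<omega>) = Y (\<tau> \<omega>) \<omega>"
    using Z_lim by eventually_elim (rule limI)
  ultimately have Y_meas [measurable]: "(\<lambda>\<omega>. Y (\<tau> \<omega>) \<omega>) \<in> borel_measurable M"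
    by (rule borel_measurable_AE_eq)
  have [measurable]: "H \<in> borel_measurable borel" using H(1) by (rule borel_measurable_continuous_onI)
  have "(\<lambda>m. expectation (Z m)) \<longlonglongrightarrow> expectation (\<lambda>\<omega>. Y (\<tau> \<omega>) \<omega>)"
  proof (rule integral_dominated_convergence[where w = "\<lambda>_. 1"])
    show "AE \<omega> in M. norm (Z m \<omega>) \<le> 1" for m
      using bound by eventually_elim (auto simp: Z_def grid_above_nonneg)
  qed (use Z_lim in auto)
  moreover have "(\<lambda>m. expectation (\<lambda>\<omega>. H (grid_above m (grid_index m (\<tau> \<omega>))))) \<longlonglongrightarrow> expectation (\<lambda>\<omega>. H (\<tau> \<omega>))"
  proof (rule integral_dominated_convergence[where w = "\<lambda>_. 1"])
    show "AE \<omega> in M. (\<lambda>m. H (grid_above m (grid_index m (\<tau> \<omega>)))) \<longlonglongrightarrow> H (\<tau> \<omega>)"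
      using \<tau>_nonneg
    proof eventually_elim
      case (elim \<omega>)
      have "(\<lambda>m. grid_above m (grid_index m (\<tau> \<omega>))) \<longlonglongrightarrow> \<tau> \<omega>"
        using grid_above_tendsto[OF elim] by (simp add: filterlim_at)
      moreover have "isCont H (\<tau> \<omega>)" using H(1) by (simp add: continuous_on_eq_continuous_at)
      ultimately show ?case by (rule isCont_tendsto_compose[rotated])
    qed
  qed (use H(2) grid_above_nonneg in \<open>auto simp: grid_above_def\<close>)
  moreover have "expectation (Z m) = expectation (\<lambda>\<omega>. H (grid_above m (grid_index m (\<tau> \<omega>))))" for m
    unfolding Z_def
  proof (rule expectation_at_countable_time[where q = "grid_above m" and J = "\<lambda>\<omega>. grid_index m (\<tau> \<omega>)"
        and Y = Y and H = H])
    show "AE \<omega> in M. \<forall>i. \<bar>Y (grid_above m i) \<omega>\<bar> \<le> 1"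
      using bound by eventually_elim (auto simp: grid_above_nonneg)
    fix i
    let ?A = "{x. grid_index m x = i}"
    have "?A \<in> sets borel" by measurable
    moreover have "indicator ?A (\<tau> \<omega>) = (indicator {i} (grid_index m (\<tau> \<omega>)) :: real)" for \<omega>
      by (simp add: indicator_def)
    ultimately show "(LINT \<omega>|M. indicator {i} (grid_index m (\<tau> \<omega>)) * Y (grid_above m i) \<omega>) =
        (LINT \<omega>|M. indicator {i} (grid_index m (\<tau> \<omega>))) * H (grid_above m i)"
      using indep[OF grid_above_nonneg, of ?A] by simp
  qed (auto intro: meas H(2) grid_above_nonneg)
  ultimately have "expectation (\<lambda>\<omega>. Y (\<tau> \<omega>) \<omega>) = expectation (\<lambda>\<omega>. H (\<tau> \<omega>))"
    by (simp add: LIMSEQ_unique)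
  with Y_meas show ?thesis ..
qed

section \<open>Inverses of nondecreasing right-continuous paths\<close>

definition subordinator_path :: "(real \<Rightarrow> real) \<Rightarrow> bool" where
  "subordinator_path v \<longleftrightarrow> mono_on {0..} v \<and> v 0 = 0 \<and> (\<forall>t\<ge>0. continuous (at_right t) v)"

lemma subordinator_pathD:
  assumes "subordinator_path v"
  shows "0 \<le> s \<Longrightarrow> s \<le> t \<Longrightarrow> v s \<le> v t" and "v 0 = 0" and "0 \<le> t \<Longrightarrow> 0 \<le> v t"
    and "0 \<le> t \<Longrightarrow> continuous (at_right t) v"
  using assms mono_onD[of "{0..}" v s t] mono_onD[of "{0..}" v 0 t] by (auto simp: subordinator_path_def)

text \<open>
  A right limit in the inner path may be attained (the inner path can be constant
  for a while), so right limits do not compose by themselves; the value of the outer path at the limit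
  point has to be taken into account.
\<close>

lemma subordinator_path_compose:
  assumes v: "subordinator_path v" and w: "subordinator_path w"
  shows "subordinator_path (\<lambda>t. v (w t))"
  unfolding subordinator_path_def
proof (intro conjI allI impI)
  show "mono_on {0..} (\<lambda>t. v (w t))"
    using subordinator_pathD[OF v] subordinator_pathD[OF w] by (auto intro!: mono_onI)
  show "v (w 0) = 0" using subordinator_pathD[OF v] subordinator_pathD[OF w] by simp
  fix t :: real assume t: "0 \<le> t"
  have w_lim: "(w \<longlongrightarrow> w t) (at_right t)" using subordinator_pathD(4)[OF w t] by (simp add: continuous_within)
  have w_ge: "\<forall>\<^sub>F s in at_right t. w t \<le> w s"
    using eventually_at_right_less[of t] by eventually_elim (use subordinator_pathD(1)[OF w t] in auto)
  have v_lim: "(v \<longlongrightarrow> v (w t)) (at_right (w t))"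
    using subordinator_pathD(4)[OF v subordinator_pathD(3)[OF w t]] by (simp add: continuous_within)
  show "continuous (at_right t) (\<lambda>t. v (w t))"
    unfolding continuous_within
  proof (rule topological_tendstoI)
    fix S assume S: "open S" "v (w t) \<in> S"
    then obtain b where b: "b > w t" "\<And>x. w t < x \<Longrightarrow> x < b \<Longrightarrow> v x \<in> S"
      using topological_tendstoD[OF v_lim S] by (auto simp: eventually_at_right_field)
    show "\<forall>\<^sub>F s in at_right t. v (w s) \<in> S"
      using order_tendstoD(2)[OF w_lim b(1)] w_ge
    proof eventually_elim
      case (elim s)
      then show ?case using b(2)[of "w s"] S(2) by (cases "w s = w t") auto
    qed
  qed
qed

lemma subordinator_path_scale: "subordinator_path w \<Longrightarrow> c \<ge> 0 \<Longrightarrow> subordinator_path (\<lambda>t. c * w t)"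
  by (auto simp: subordinator_path_def mono_on_def mult_left_mono intro!: continuous_intros)

lemma subordinator_path_sum: "(\<And>i. i \<in> I \<Longrightarrow> subordinator_path (w i)) \<Longrightarrow> subordinator_path (\<lambda>t. \<Sum>i\<in>I. w i t)"
  by (auto simp: subordinator_path_def mono_on_def intro!: continuous_intros sum_mono)

context
  fixes v :: "real \<Rightarrow> real" and e :: "real \<Rightarrow> real"
  assumes v: "subordinator_path v" and unbounded: "\<And>t. \<exists>s\<ge>0. v s > t"
    and e: "\<And>t. e t = Inf {s. 0 \<le> s \<and> v s > t}"
begin

lemma level_set: "{s. 0 \<le> s \<and> v s > t} \<noteq> {}" "bdd_below {s. 0 \<le> s \<and> v s > t}"
  using unbounded[of t] by (auto intro: bdd_belowI[of _ 0])

lemma inverse_path_nonneg: "e t \<ge> 0"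
  unfolding e by (rule cInf_greatest[OF level_set(1)]) auto

lemma less_inverse_pathD: "0 \<le> s \<Longrightarrow> s < e t \<Longrightarrow> v s \<le> t"
  unfolding e using cInf_lower[OF _ level_set(2), of s t] by force

text \<open>
  By right-continuity, \<open>v\<close> is still below \<open>t\<close> at some time strictly after \<open>s\<close>, and the level
  \<open>t\<close> is exceeded later still.
\<close>

lemma less_inverse_pathI:
  assumes "0 \<le> s" "v s < t"
  shows "s < e t"
proof -
  have "(v \<longlongrightarrow> v s) (at_right s)" using subordinator_pathD(4)[OF v \<open>0 \<le> s\<close>] by (simp add: continuous_within)
  then have "\<forall>\<^sub>F x in at_right s. v x < t" using assms(2) by (rule order_tendstoD)
  then obtain b where b: "b > s" "\<And>x. s < x \<Longrightarrow> x < b \<Longrightarrow> v x < t"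
    by (auto simp: eventually_at_right_field)
  define x where "x = (s + b) / 2"
  have x: "s < x" "v x < t" using b by (auto simp: x_def)
  have "x \<le> e t"
    unfolding e
  proof (rule cInf_greatest[OF level_set(1)])
    fix y assume y: "y \<in> {s. 0 \<le> s \<and> v s > t}"
    show "x \<le> y"
    proof (rule ccontr)
      assume "\<not> x \<le> y"
      then have "v y \<le> v x" using y by (intro subordinator_pathD(1)[OF v]) auto
      then show False using x y by simp
    qed
  qed
  then show ?thesis using x by simp
qed

lemma inverse_path_mono: "t \<le> t' \<Longrightarrow> e t \<le> e t'"
  unfolding e by (rule cInf_superset_mono[OF level_set(1) level_set(2)]) auto

lemma inverse_path_right_continuous: "continuous (at_right t) e"
  unfolding continuous_within
proof (rule order_tendstoI)
  fix a assume *: "a < e t"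
  show "\<forall>\<^sub>F x in at_right t. a < e x"
    using eventually_at_right_less[of t] by eventually_elim (rule less_le_trans[OF * inverse_path_mono], simp)
next
  fix a assume "e t < a"
  then obtain s where s: "0 \<le> s" "v s > t" "s < a"
    unfolding e using cInf_lessD[OF level_set(1)] by blast
  have "\<forall>\<^sub>F x in at_right t. x < v s"
    using s(2) by (auto simp: eventually_at_right_field)
  then show "\<forall>\<^sub>F x in at_right t. e x < a"
  proof eventually_elim
    case (elim x)
    then have "e x \<le> s" unfolding e using s by (intro cInf_lower[OF _ level_set(2)]) auto
    then show ?case using s by simp
  qed
qed

end

text \<open>
  The transform in \<open>t\<close> of the indicator of \<open>t > a\<close>, which is used with \<open>a = V\<^sub>s\<close>.
\<close>

lemma exp_tail_integral:
  fixes u :: real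
  assumes "u > 0"
  shows "(LINT t|lborel. indicator {a<..} t * exp (- u * t)) = exp (- u * a) / u"
proof -
  have "(LINT t|lborel. indicator {a<..} t * exp (- u * t)) =
      (LINT t|lborel. indicator {a<..} (a + t) * exp (- u * (a + t)))"
    using lborel_integral_real_affine[of 1 "\<lambda>t. indicator {a<..} t * exp (- u * t)" a] by simp
  also have "\<dots> = (LINT t|lborel. exp (- u * a) * (indicator {0<..} t *\<^sub>R exp (- u * t)))"
    by (intro Bochner_Integration.integral_cong) (auto simp: indicator_def exp_add[symmetric] algebra_simps)
  also have "\<dots> = exp (- u * a) / u"
    using laplace_one[OF assms] by (simp add: set_lebesgue_integral_def)
  finally show ?thesis .
qed

text \<open>
  Write \<open>h(E\<^sub>t) - h(0)\<close> as the integral of \<open>h'(s)\<close> over \<open>0 < s < E\<^sub>t\<close> and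
  exchange the integrals over \<open>s\<close>, \<open>t\<close> and \<open>\<omega>\<close>. For fixed \<open>s\<close> and \<open>\<omega>\<close>
  the condition \<open>s < E\<^sub>t\<close> means \<open>V\<^sub>s < t\<close> for almost all \<open>t\<close>, so the integral over
  \<open>t\<close> is \<open>exp (- u V\<^sub>s) / u\<close>, and its expectation is known.
\<close>

lemma (in prob_space) laplace_of_inverse_process:
  fixes V E :: "real \<Rightarrow> 'a \<Rightarrow> real" and h h' :: "real \<Rightarrow> real"
  assumes paths: "AE \<omega> in M. subordinator_path (\<lambda>s. V s \<omega>) \<and> (\<forall>t. \<exists>s\<ge>0. V s \<omega> > t)"
    and E: "\<And>t \<omega>. E t \<omega> = Inf {s. 0 \<le> s \<and> V s \<omega> > t}"
    and E_meas: "\<And>t. t \<ge> 0 \<Longrightarrow> E t \<in> borel_measurable M"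
    and V_laplace: "\<And>s. s \<ge> 0 \<Longrightarrow> expectation (\<lambda>\<omega>. exp (- u * V s \<omega>)) = exp (- \<psi> * s)"
    and u: "u > 0"
    and h_cont: "continuous_on UNIV h" and h_bound: "\<And>x. x \<ge> 0 \<Longrightarrow> \<bar>h x\<bar> \<le> 1"
    and h': "\<And>x. x \<ge> 0 \<Longrightarrow> (LINT s:{0<..<x}|lborel. h' s) = h x - h 0"
    and h'_int: "set_integrable lborel {0<..} h'"
  shows "(LINT t:{0<..}|lborel. exp (- u * t) * expectation (\<lambda>\<omega>. h (E t \<omega>))) =
    h 0 / u + (LINT s:{0<..}|lborel. exp (- \<psi> * s) * h' s) / u"
    and "(\<lambda>t. indicator {0<..} t * expectation (\<lambda>\<omega>. h (E t \<omega>))) \<in> borel_measurable lborel"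
proof -
  interpret Q: pair_sigma_finite M lborel ..
  interpret R: pair_sigma_finite "M \<Otimes>\<^sub>M lborel" "lborel :: real measure" ..
  obtain N where N: "{\<omega> \<in> space M. \<not> (subordinator_path (\<lambda>s. V s \<omega>) \<and> (\<forall>t. \<exists>s\<ge>0. V s \<omega> > t))} \<subseteq> N"
      "emeasure M N = 0" "N \<in> sets M"
    using paths by (rule AE_E)
  define G where "G = space M - N"
  have G [measurable]: "G \<in> sets M" using N by (auto simp: G_def)
  have G_AE: "AE \<omega> in M. \<omega> \<in> G"
    using AE_not_in[of N M] N AE_space by (auto simp: G_def null_sets_def elim: AE_mp)
  have good: "subordinator_path (\<lambda>s. V s \<omega>)" "\<And>t. \<exists>s\<ge>0. V s \<omega> > t" if "\<omega> \<in> G" for \<omega>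
    using that N by (auto simp: G_def)
  note inverse = inverse_path_nonneg[OF good E] less_inverse_pathD[OF good E] less_inverse_pathI[OF good E]
    inverse_path_right_continuous[OF good E]
  \<comment> \<open>A version of the hitting time that is jointly measurable in \<open>(\<omega>, t)\<close>: it is set to \<open>0\<close> off
    the good event and frozen for negative times, so that it is a limit of grid approximations everywhere.\<close>
  define e where "e = (\<lambda>(\<omega>, t). if \<omega> \<in> G then E (max 0 t) \<omega> else 0)"
  have e_nonneg: "e p \<ge> 0" for p
    using inverse(1) by (auto simp: e_def split: prod.split)
  have [measurable]: "e \<in> borel_measurable (M \<Otimes>\<^sub>M lborel)"
  proof (rule borel_measurable_LIMSEQ_real)
    define e_grid where "e_grid m = (\<lambda>(\<omega>, t). if \<omega> \<in> G then E (grid_above m (grid_index m (max 0 t))) \<omega> else 0)" for m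
    show "e_grid m \<in> borel_measurable (M \<Otimes>\<^sub>M lborel)" for m
    proof -
      have [measurable]: "E (grid_above m i) \<in> borel_measurable M" for i
        by (rule E_meas[OF grid_above_nonneg])
      have "(\<lambda>p. (\<lambda>i p. if fst p \<in> G then E (grid_above m i) (fst p) else 0) (grid_index m (max 0 (snd p))) p)
          \<in> borel_measurable (M \<Otimes>\<^sub>M lborel)"
        by (rule measurable_compose_countable) measurable
      then show ?thesis by (simp add: e_grid_def case_prod_beta')
    qed
    show "(\<lambda>m. e_grid m p) \<longlonglongrightarrow> e p" for p
    proof (cases p)
      case (Pair \<omega> t)
      show ?thesis
      proof (cases "\<omega> \<in> G")
        case True
        have "((\<lambda>t. E t \<omega>) \<longlongrightarrow> E (max 0 t) \<omega>) (at_right (max 0 t))"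
          using inverse(4)[OF True] True by (simp add: continuous_within)
        from filterlim_compose[OF this grid_above_tendsto] show ?thesis
          using True by (simp add: Pair e_grid_def e_def)
      qed (simp add: Pair e_grid_def e_def)
    qed
  qed
  \<comment> \<open>The kernels \<open>a\<close> and \<open>b\<close> dominate the integrand \<open>F\<close> by an integrable product.\<close>
  define a where "a = (\<lambda>t. indicator {0<..} t * exp (- u * t))"
  define b where "b = (\<lambda>s. indicator {0<..} s * h' s)"
  have a_int: "integrable lborel a"
    using integrable_I0i_exp_mscale[OF u] by (simp add: a_def set_integrable_def mult.commute)
  have b_int: "integrable lborel b"
    using h'_int by (simp add: b_def set_integrable_def)
  have [measurable]: "a \<in> borel_measurable borel" "b \<in> borel_measurable borel"
    using a_int b_int by (auto dest: borel_measurable_integrable)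
  have a_int2: "integrable (M \<Otimes>\<^sub>M lborel) (\<lambda>p. a (snd p))"
    using integrable_prod_mult[of M lborel "\<lambda>_. 1" a] a_int sigma_finite_lborel sigma_finite_measure_axioms
    by (simp add: case_prod_beta')
  define F where "F p s = a (snd p) * b s * indicator {..<e p} s" for p s
  have F_meas [measurable]: "(\<lambda>(p, s). F p s) \<in> borel_measurable ((M \<Otimes>\<^sub>M lborel) \<Otimes>\<^sub>M lborel)"
  proof -
    have "(\<lambda>(p, s). F p s) = (\<lambda>(p, s). a (snd p) * b s * (if s < e p then 1 else 0))"
      by (auto simp: F_def indicator_def)
    then show ?thesis by simp
  qed
  have F_int: "integrable ((M \<Otimes>\<^sub>M lborel) \<Otimes>\<^sub>M lborel) (\<lambda>(p, s). F p s)"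
  proof (rule Bochner_Integration.integrable_bound)
    show "integrable ((M \<Otimes>\<^sub>M lborel) \<Otimes>\<^sub>M lborel) (\<lambda>(p, s). a (snd p) * b s)"
      by (rule integrable_prod_mult[OF Q.P.sigma_finite_measure_axioms sigma_finite_lborel a_int2 b_int])
  qed (use F_meas in \<open>auto simp: F_def indicator_def\<close>)
  have F_s: "(LINT s|lborel. F p s) = a (snd p) * (h (e p) - h 0)" for p
  proof -
    have "F p s = a (snd p) * (indicator {0<..<e p} s *\<^sub>R h' s)" for s
      by (simp add: F_def b_def indicator_def)
    then have "(LINT s|lborel. F p s) = a (snd p) * (LINT s:{0<..<e p}|lborel. h' s)"
      by (simp add: set_lebesgue_integral_def)
    then show ?thesis by (simp add: h'[OF e_nonneg])
  qed
  have F_t: "(LINT t|lborel. F (\<omega>, t) s) = b s * (exp (- u * V s \<omega>) / u)" if \<omega>: "\<omega> \<in> G" for \<omega> s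
  proof (cases "s > 0")
    case True
    have V: "V s \<omega> \<ge> 0" using subordinator_pathD(3)[OF good(1)[OF \<omega>]] True by simp
    have "(LINT t|lborel. F (\<omega>, t) s) = (LINT t|lborel. b s * (indicator {V s \<omega><..} t * exp (- u * t)))"
    proof (rule integral_cong_AE)
      show "AE t in lborel. F (\<omega>, t) s = b s * (indicator {V s \<omega><..} t * exp (- u * t))"
        using AE_lborel_singleton[of "V s \<omega>"]
      proof eventually_elim
        case (elim t)
        show ?case
        proof (cases "t > 0")
          case t: True
          then have "s < e (\<omega>, t) \<longleftrightarrow> V s \<omega> < t"
            using inverse(2)[OF \<omega>, of s t] inverse(3)[OF \<omega>, of s t] elim True \<omega> by (auto simp: e_def max_def)
          then show ?thesis using t by (simp add: F_def a_def indicator_def)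
        next
          case False
          then show ?thesis using V by (simp add: F_def a_def indicator_def)
        qed
      qed
      show "(\<lambda>t. F (\<omega>, t) s) \<in> borel_measurable lborel"
      proof -
        have "\<omega> \<in> space M" using \<omega> by (simp add: G_def)
        then have "(\<lambda>t. ((\<omega>, t), s)) \<in> measurable lborel ((M \<Otimes>\<^sub>M lborel) \<Otimes>\<^sub>M lborel)" by measurable
        from measurable_compose[OF this F_meas] show ?thesis by simp
      qed
    qed measurable
    then show ?thesis by (simp only: integral_mult_right_zero exp_tail_integral[OF u])
  qed (simp add: F_def b_def)
  have F_p: "(LINT p|(M \<Otimes>\<^sub>M lborel). F p s) = b s * (exp (- \<psi> * s) / u)" for s
  proof (cases "s > 0")
    case True
    have "integrable (M \<Otimes>\<^sub>M lborel) (\<lambda>p. F p s)"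
    proof (rule Bochner_Integration.integrable_bound)
      show "integrable (M \<Otimes>\<^sub>M lborel) (\<lambda>p. a (snd p) * b s)" using a_int2 by simp
      have "(\<lambda>p. (p, s)) \<in> measurable (M \<Otimes>\<^sub>M lborel) ((M \<Otimes>\<^sub>M lborel) \<Otimes>\<^sub>M lborel)" by measurable
      from measurable_compose[OF this F_meas] show "(\<lambda>p. F p s) \<in> borel_measurable (M \<Otimes>\<^sub>M lborel)" by simp
    qed (auto simp: F_def indicator_def)
    then have F_int': "integrable (M \<Otimes>\<^sub>M lborel) (\<lambda>(\<omega>, t). F (\<omega>, t) s)" by (simp add: case_prod_beta')
    have "(LINT p|(M \<Otimes>\<^sub>M lborel). F p s) = (LINT \<omega>|M. LINT t|lborel. F (\<omega>, t) s)"
      using Q.integral_fst[OF F_int'] by (simp add: case_prod_beta')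
    also have "\<dots> = (LINT \<omega>|M. b s * (exp (- u * V s \<omega>) / u))"
    proof -
      have "integrable M (\<lambda>\<omega>. exp (- u * V s \<omega>))"
        using V_laplace[of s] True not_integrable_integral_eq[of M "\<lambda>\<omega>. exp (- u * V s \<omega>)"]
        by (metis exp_not_eq_zero less_imp_le)
      then have "(\<lambda>\<omega>. exp (- u * V s \<omega>)) \<in> borel_measurable M" by (rule borel_measurable_integrable)
      moreover have "(\<lambda>\<omega>. LINT t|lborel. F (\<omega>, t) s) \<in> borel_measurable M"
        using Q.integrable_fst[OF F_int'] by (rule borel_measurable_integrable)
      ultimately show ?thesis
        using G_AE F_t by (intro integral_cong_AE) (auto elim: AE_mp)
    qed
    also have "\<dots> = b s * (exp (- \<psi> * s) / u)"
      using V_laplace[of s] True by simp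
    finally show ?thesis .
  qed (simp add: F_def b_def)
  have H_int: "integrable (M \<Otimes>\<^sub>M lborel) (\<lambda>(\<omega>, t). a t * (h (e (\<omega>, t)) - h 0))"
    using R.integrable_fst[OF F_int] by (simp add: F_s case_prod_beta')
  have [measurable]: "h \<in> borel_measurable borel" using h_cont by (rule borel_measurable_continuous_onI)
  define q where "q t = expectation (\<lambda>\<omega>. h (E t \<omega>))" for t
  have q: "(LINT \<omega>|M. a t * (h (e (\<omega>, t)) - h 0)) = a t * q t - a t * h 0" for t
  proof (cases "t > 0")
    case True
    have [measurable]: "E t \<in> borel_measurable M" using E_meas True by simp
    have bd: "AE \<omega> in M. \<bar>h (E t \<omega>)\<bar> \<le> 1"
      using G_AE by eventually_elim (use inverse(1) h_bound in auto)
    have hE: "integrable M (\<lambda>\<omega>. h (E t \<omega>))"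
      by (rule integrable_const_bound[of _ 1]) (use bd in auto)
    have [measurable]: "(\<lambda>\<omega>. e (\<omega>, t)) \<in> borel_measurable M" by measurable
    have "(LINT \<omega>|M. a t * (h (e (\<omega>, t)) - h 0)) = (LINT \<omega>|M. a t * (h (E t \<omega>) - h 0))"
    proof (rule integral_cong_AE)
      show "AE \<omega> in M. a t * (h (e (\<omega>, t)) - h 0) = a t * (h (E t \<omega>) - h 0)"
        using G_AE by eventually_elim (use True in \<open>simp add: e_def max_def\<close>)
    qed measurable
    also have "\<dots> = a t * (q t - h 0)" using hE by (simp add: q_def prob_space)
    finally show ?thesis by (simp add: right_diff_distrib)
  qed (simp add: a_def)
  have aq_int: "integrable lborel (\<lambda>t. a t * q t)"
  proof -
    have "integrable lborel (\<lambda>t. (a t * q t - a t * h 0) + a t * h 0)"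
      using Q.integrable_snd[OF H_int] a_int unfolding q by (intro Bochner_Integration.integrable_add) auto
    then show ?thesis by simp
  qed
  have "(LINT t|lborel. a t * q t - a t * h 0) = (LINT p|(M \<Otimes>\<^sub>M lborel). LINT s|lborel. F p s)"
    using Q.integral_snd[OF H_int] unfolding q by (simp add: F_s case_prod_beta')
  also have "\<dots> = (LINT s|lborel. LINT p|(M \<Otimes>\<^sub>M lborel). F p s)"
    using R.Fubini_integral[OF F_int] by simp
  also have "\<dots> = (LINT s|lborel. (indicator {0<..} s *\<^sub>R (exp (- \<psi> * s) * h' s)) / u)"
    by (intro Bochner_Integration.integral_cong) (auto simp: F_p b_def)
  also have "\<dots> = (LINT s:{0<..}|lborel. exp (- \<psi> * s) * h' s) / u"
    by (simp add: set_lebesgue_integral_def)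
  finally have "(LINT t|lborel. a t * q t) - (LINT t|lborel. a t) * h 0 =
      (LINT s:{0<..}|lborel. exp (- \<psi> * s) * h' s) / u"
    using aq_int a_int by simp
  moreover have "(LINT t|lborel. a t) = 1 / u"
    using exp_tail_integral[OF u, of 0] by (simp add: a_def)
  moreover have "(LINT t|lborel. a t * q t) = (LINT t:{0<..}|lborel. exp (- u * t) * q t)"
    by (simp add: set_lebesgue_integral_def a_def mult.assoc)
  ultimately show "(LINT t:{0<..}|lborel. exp (- u * t) * expectation (\<lambda>\<omega>. h (E t \<omega>))) =
    h 0 / u + (LINT s:{0<..}|lborel. exp (- \<psi> * s) * h' s) / u"
    by (simp add: q_def)
  have "(\<lambda>t. exp (u * t) * (a t * q t)) \<in> borel_measurable lborel"
    using borel_measurable_integrable[OF aq_int] by measurable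
  moreover have "exp (u * t) * a t = indicator {0<..} t" for t
    by (simp add: a_def exp_minus)
  ultimately show "(\<lambda>t. indicator {0<..} t * expectation (\<lambda>\<omega>. h (E t \<omega>))) \<in> borel_measurable lborel"
    by (simp add: q_def mult.assoc[symmetric])
qed

lemma (in prob_space) expectation_inverse_process_right_continuous:
  fixes V E :: "real \<Rightarrow> 'a \<Rightarrow> real" and h :: "real \<Rightarrow> real"
  assumes paths: "AE \<omega> in M. subordinator_path (\<lambda>s. V s \<omega>) \<and> (\<forall>t. \<exists>s\<ge>0. V s \<omega> > t)"
    and E: "\<And>t \<omega>. E t \<omega> = Inf {s. 0 \<le> s \<and> V s \<omega> > t}"
    and E_meas: "\<And>t. t \<ge> 0 \<Longrightarrow> E t \<in> borel_measurable M"
    and h_cont: "continuous_on UNIV h" and h_bound: "\<And>x. x \<ge> 0 \<Longrightarrow> \<bar>h x\<bar> \<le> 1"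
    and "t \<ge> 0"
  shows "continuous (at_right t) (\<lambda>t. expectation (\<lambda>\<omega>. h (E t \<omega>)))"
  unfolding continuous_within
proof (rule tendsto_at_right_sequentially[of t "t + 1"])
  fix S :: "nat \<Rightarrow> real" assume S: "\<And>n. t < S n" "S \<longlonglongrightarrow> t"
  have [measurable]: "h \<in> borel_measurable borel" using h_cont by (rule borel_measurable_continuous_onI)
  have E' [measurable]: "E t \<in> borel_measurable M" "E (S n) \<in> borel_measurable M" for n
    using E_meas[of t] E_meas[of "S n"] S(1)[of n] \<open>t \<ge> 0\<close> by auto
  show "(\<lambda>n. expectation (\<lambda>\<omega>. h (E (S n) \<omega>))) \<longlonglongrightarrow> expectation (\<lambda>\<omega>. h (E t \<omega>))"
  proof (rule integral_dominated_convergence[where w = "\<lambda>_. 1"])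
    show "AE \<omega> in M. (\<lambda>n. h (E (S n) \<omega>)) \<longlonglongrightarrow> h (E t \<omega>)"
      using paths
    proof eventually_elim
      case (elim \<omega>)
      then have "continuous (at_right t) (\<lambda>t. E t \<omega>)"
        by (intro inverse_path_right_continuous[of "\<lambda>s. V s \<omega>" "\<lambda>t. E t \<omega>"]) (auto simp: E)
      then have lim: "((\<lambda>t. E t \<omega>) \<longlongrightarrow> E t \<omega>) (at_right t)" by (simp add: continuous_within)
      have "filterlim S (at_right t) sequentially"
        using S by (auto simp: filterlim_at intro!: always_eventually)
      from filterlim_compose[OF lim this] have "(\<lambda>n. E (S n) \<omega>) \<longlonglongrightarrow> E t \<omega>" .
      moreover have "isCont h (E t \<omega>)" using h_cont by (simp add: continuous_on_eq_continuous_at)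
      ultimately show ?case by (rule isCont_tendsto_compose[rotated])
    qed
    show "AE \<omega> in M. norm (h (E (S n) \<omega>)) \<le> 1" for n
      using paths
    proof eventually_elim
      case (elim \<omega>)
      then have "E (S n) \<omega> \<ge> 0"
        by (intro inverse_path_nonneg[of "\<lambda>s. V s \<omega>" "\<lambda>t. E t \<omega>"]) (auto simp: E)
      then show ?case using h_bound by simp
    qed
  qed auto
qed simp

section \<open>Poisson weights\<close>

definition poisson_weight :: "real \<Rightarrow> nat \<Rightarrow> real \<Rightarrow> real" where
  "poisson_weight \<Lambda> k x = (\<Lambda> * x) ^ k / fact k * exp (- \<Lambda> * x)"

lemma poisson_weight_continuous: "continuous_on UNIV (poisson_weight \<Lambda> k)"
  unfolding poisson_weight_def[abs_def] by (intro continuous_intros) auto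

lemma poisson_weight_bounds:
  assumes "\<Lambda> \<ge> 0" "x \<ge> 0"
  shows "0 \<le> poisson_weight \<Lambda> k x" "poisson_weight \<Lambda> k x \<le> 1"
proof -
  show "0 \<le> poisson_weight \<Lambda> k x" using assms by (simp add: poisson_weight_def)
  have nn: "\<Lambda> * x \<ge> 0" using assms by simp
  have "(\<Sum>n\<in>{k}. (\<Lambda> * x) ^ n /\<^sub>R fact n) \<le> (\<Sum>n. (\<Lambda> * x) ^ n /\<^sub>R fact n)"
    by (rule sum_le_suminf) (use nn summable_exp_generic[of "\<Lambda> * x"] in auto)
  then have "(\<Lambda> * x) ^ k / fact k \<le> exp (\<Lambda> * x)"
    by (simp add: exp_def divide_inverse mult.commute)
  then have "(\<Lambda> * x) ^ k / fact k * exp (- \<Lambda> * x) \<le> exp (\<Lambda> * x) * exp (- \<Lambda> * x)"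
    by (intro mult_right_mono) auto
  then show "poisson_weight \<Lambda> k x \<le> 1" by (simp add: poisson_weight_def exp_minus)
qed

lemma poisson_weight_0: "poisson_weight \<Lambda> k 0 = (if k = 0 then 1 else 0)"
  by (simp add: poisson_weight_def)

definition poisson_weight_deriv :: "real \<Rightarrow> nat \<Rightarrow> real \<Rightarrow> real" where
  "poisson_weight_deriv \<Lambda> k x =
     \<Lambda> * (if k = 0 then 0 else poisson_weight \<Lambda> (k - 1) x) - \<Lambda> * poisson_weight \<Lambda> k x"

lemma poisson_weight_has_derivative:
  "(poisson_weight \<Lambda> k has_real_derivative poisson_weight_deriv \<Lambda> k x) (at x)"
proof (cases k)
  case 0
  then show ?thesis
    unfolding poisson_weight_def[abs_def] poisson_weight_deriv_def
    by (auto intro!: derivative_eq_intros)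
next
  case (Suc j)
  have "((\<lambda>x. (\<Lambda> * x) ^ Suc j / fact (Suc j)) has_real_derivative \<Lambda> * ((\<Lambda> * x) ^ j / fact j)) (at x)"
    by (rule derivative_eq_intros refl | simp)+
  moreover have "((\<lambda>x. exp (- \<Lambda> * x)) has_real_derivative - \<Lambda> * exp (- \<Lambda> * x)) (at x)"
    by (auto intro!: derivative_eq_intros)
  ultimately have "((\<lambda>x. (\<Lambda> * x) ^ Suc j / fact (Suc j) * exp (- \<Lambda> * x)) has_real_derivative
      \<Lambda> * ((\<Lambda> * x) ^ j / fact j) * exp (- \<Lambda> * x) + - \<Lambda> * exp (- \<Lambda> * x) * ((\<Lambda> * x) ^ Suc j / fact (Suc j))) (at x)"
    by (rule DERIV_mult)
  then show ?thesis
    by (simp add: Suc poisson_weight_def[abs_def] poisson_weight_deriv_def mult_ac del: fact_Suc power_Suc)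
qed

lemma poisson_weight_laplace:
  assumes "\<Lambda> > 0" "\<psi> \<ge> 0"
  shows "has_bochner_integral lborel (\<lambda>s. indicator {0<..} s *\<^sub>R (exp (- \<psi> * s) * poisson_weight \<Lambda> k s))
    (\<Lambda> ^ k / (\<psi> + \<Lambda>) ^ (k + 1))"
proof -
  have "has_bochner_integral lborel
      (\<lambda>s. \<Lambda> ^ k / fact k * (indicator {0<..} s * (s powr real k * exp (- (\<psi> + \<Lambda>) * s))))
      (\<Lambda> ^ k / fact k * (Gamma (real k + 1) * (\<psi> + \<Lambda>) powr (- (real k + 1))))"
    using assms by (intro has_bochner_integral_mult_right has_bochner_integral_powr_exp) auto
  moreover have "\<Lambda> ^ k / fact k * (indicator {0<..} s * (s powr real k * exp (- (\<psi> + \<Lambda>) * s))) =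
      indicator {0<..} s *\<^sub>R (exp (- \<psi> * s) * poisson_weight \<Lambda> k s)" for s :: real
    by (auto simp: poisson_weight_def indicator_def powr_realpow power_mult_distrib exp_add[symmetric] algebra_simps)
  moreover have "\<Lambda> ^ k / fact k * (Gamma (real k + 1) * (\<psi> + \<Lambda>) powr (- (real k + 1))) = \<Lambda> ^ k / (\<psi> + \<Lambda>) ^ (k + 1)"
  proof -
    have "(\<psi> + \<Lambda>) powr (real k + 1) = (\<psi> + \<Lambda>) ^ (k + 1)"
      using assms powr_realpow[of "\<psi> + \<Lambda>" "k + 1"] by (simp add: add.commute)
    then show ?thesis
      using Gamma_fact[of k, where 'a = real]
      by (simp only: powr_minus) (simp add: add.commute divide_inverse)
  qed
  ultimately show ?thesis by simp
qed

text \<open>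
  The derivative of a Poisson weight is \<open>\<Lambda>\<close> times the difference of two consecutive weights, and
  the weight \<open>k\<close> has the transform \<open>\<Lambda>\<^sup>k / (\<psi> + \<Lambda>)\<^sup>k\<^sup>+\<^sup>1\<close>. The case
  \<open>\<psi> = 0\<close> also gives the integrability of the derivative itself.
\<close>

lemma poisson_weight_deriv_laplace:
  assumes "\<Lambda> > 0" "\<psi> \<ge> 0"
  shows "has_bochner_integral lborel (\<lambda>s. indicator {0<..} s *\<^sub>R (exp (- \<psi> * s) * poisson_weight_deriv \<Lambda> k s))
    (\<psi> * \<Lambda> ^ k / (\<psi> + \<Lambda>) ^ (k + 1) - (if k = 0 then 1 else 0))"
proof (cases k)
  case 0
  have "has_bochner_integral lborel
      (\<lambda>s. - \<Lambda> * (indicator {0<..} s *\<^sub>R (exp (- \<psi> * s) * poisson_weight \<Lambda> 0 s))) (- \<Lambda> * (\<Lambda> ^ 0 / (\<psi> + \<Lambda>) ^ (0 + 1)))"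
    by (intro has_bochner_integral_mult_right poisson_weight_laplace assms)
  moreover have "- \<Lambda> * (\<Lambda> ^ 0 / (\<psi> + \<Lambda>) ^ (0 + 1)) = \<psi> * \<Lambda> ^ k / (\<psi> + \<Lambda>) ^ (k + 1) - (if k = 0 then 1 else 0)"
    using assms by (simp add: 0 field_simps)
  ultimately show ?thesis by (simp add: 0 poisson_weight_deriv_def mult_ac)
next
  case (Suc j)
  have "has_bochner_integral lborel
      (\<lambda>s. \<Lambda> * (indicator {0<..} s *\<^sub>R (exp (- \<psi> * s) * poisson_weight \<Lambda> j s)) -
        \<Lambda> * (indicator {0<..} s *\<^sub>R (exp (- \<psi> * s) * poisson_weight \<Lambda> k s)))
      (\<Lambda> * (\<Lambda> ^ j / (\<psi> + \<Lambda>) ^ (j + 1)) - \<Lambda> * (\<Lambda> ^ k / (\<psi> + \<Lambda>) ^ (k + 1)))"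
    by (intro has_bochner_integral_diff has_bochner_integral_mult_right poisson_weight_laplace assms)
  moreover have "\<Lambda> * (\<Lambda> ^ j / (\<psi> + \<Lambda>) ^ (j + 1)) - \<Lambda> * (\<Lambda> ^ k / (\<psi> + \<Lambda>) ^ (k + 1)) =
      \<psi> * \<Lambda> ^ k / (\<psi> + \<Lambda>) ^ (k + 1)"
  proof -
    have "\<Lambda> * (\<Lambda> ^ j / (\<psi> + \<Lambda>) ^ (j + 1)) = \<Lambda> ^ k * (\<psi> + \<Lambda>) / (\<psi> + \<Lambda>) ^ (k + 1)"
      using assms by (simp add: Suc)
    then show ?thesis by (simp add: diff_divide_distrib[symmetric] algebra_simps)
  qed
  ultimately show ?thesis
    by (simp add: Suc poisson_weight_deriv_def algebra_simps)
qed

section \<open>The subordinated sum\<close>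

lemma stable_subordinator_subordinator_path:
  assumes "stable_subordinator M \<alpha> X"
  shows "AE \<omega> in M. subordinator_path (\<lambda>t. X t \<omega>)"
proof -
  have "AE \<omega> in M. mono_on {0..} (\<lambda>t. X t \<omega>)" "AE \<omega> in M. X 0 \<omega> = 0" "AE \<omega> in M. cadlag (\<lambda>t. X t \<omega>)"
    using assms by (auto simp: stable_subordinator_def levy_process_def)
  then show ?thesis by eventually_elim (simp add: subordinator_path_def cadlag_def)
qed

lemma stable_subordinator_measurable:
  "stable_subordinator M \<alpha> X \<Longrightarrow> t \<ge> 0 \<Longrightarrow> X t \<in> borel_measurable M"
  by (simp add: stable_subordinator_def levy_process_def)

text \<open>
  For \<open>\<alpha> = 1\<close> the subordinator is a deterministic drift, which has the same formula.
\<close>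

lemma stable_subordinator_laplace:
  assumes X: "stable_subordinator M \<alpha> X" and "t \<ge> 0" "s > 0"
  shows "(LINT \<omega>|M. exp (- s * X t \<omega>)) = exp (- t * s powr \<alpha>)"
proof (cases "\<alpha> = 1")
  case True
  interpret prob_space M using X by (simp add: stable_subordinator_def levy_process_def)
  have [measurable]: "X t \<in> borel_measurable M" by (rule stable_subordinator_measurable[OF X \<open>t \<ge> 0\<close>])
  have "AE \<omega> in M. \<forall>t\<ge>0. X t \<omega> = t" using X True by (simp add: stable_subordinator_def)
  then have "AE \<omega> in M. exp (- s * X t \<omega>) = exp (- s * t)"
    by eventually_elim (use \<open>t \<ge> 0\<close> in simp)
  then have "(LINT \<omega>|M. exp (- s * X t \<omega>)) = (LINT \<omega>|M. exp (- s * t))"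
    by (intro integral_cong_AE) auto
  then show ?thesis using True \<open>s > 0\<close> by (simp add: prob_space mult.commute)
next
  case False
  then show ?thesis using assms by (simp add: stable_subordinator_def)
qed

locale subordination = prabhakar +
  fixes M :: "'b measure" and U :: "nat \<Rightarrow> real \<Rightarrow> 'b \<Rightarrow> real" and W :: "real \<Rightarrow> 'b \<Rightarrow> real"
  assumes \<gamma>_pos: "\<gamma> > 0" and prob: "prob_space M"
    and U: "\<And>r. r \<le> nat \<lceil>\<gamma>\<rceil> \<Longrightarrow>
      stable_subordinator M (\<mu> * real (nat \<lceil>\<gamma>\<rceil>) / \<gamma> - real r * \<rho>) (U r)"
    and W: "stable_subordinator M (\<gamma> / real (nat \<lceil>\<gamma>\<rceil>)) W"
    and indep: "indep_subordinators M (nat \<lceil>\<gamma>\<rceil>) U W"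
begin

abbreviation "n \<equiv> nat \<lceil>\<gamma>\<rceil>"
abbreviation "index r \<equiv> \<mu> * real n / \<gamma> - real r * \<rho>"
abbreviation "rate r \<equiv> real (n choose r) * \<phi> ^ r"
abbreviation "V \<equiv> subordinated_sum \<gamma> \<phi> U W"
abbreviation "C \<equiv> completion M"

sublocale prob_space M by (rule prob)

sublocale C: prob_space C by (rule prob_space_completion)

lemma rate_nonneg: "rate r \<ge> 0" using \<phi>_pos by simp

text \<open>
  The Laplace exponent of the sum of the outer subordinators at the times \<open>rate r * t\<close>.
\<close>

definition inner_symbol :: "real \<Rightarrow> real" where
  "inner_symbol u = (\<Sum>r = 0..n. rate r * u powr index r)"

text \<open>
  The indices decrease by \<open>\<rho>\<close> with \<open>r\<close> and the rates are binomial, so this is the binomial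
  theorem.
\<close>

lemma inner_symbol_eq:
  assumes "u > 0"
  shows "inner_symbol u = u powr (\<mu> * real n / \<gamma>) * (1 + \<phi> * u powr (- \<rho>)) ^ n"
proof -
  have "(1 + \<phi> * u powr (- \<rho>)) ^ n = (\<Sum>r = 0..n. real (n choose r) * (\<phi> * u powr (- \<rho>)) ^ r)"
    using binomial_ring[of "\<phi> * u powr (- \<rho>)" 1 n] by (simp add: add.commute atLeast0AtMost)
  moreover have "u powr index r = u powr (\<mu> * real n / \<gamma>) * (u powr (- \<rho>)) ^ r" for r
  proof -
    have "index r = \<mu> * real n / \<gamma> + (- \<rho>) * real r" by simp
    then show ?thesis using assms by (simp only: powr_add powr_powr[symmetric]) (simp add: powr_realpow)
  qed
  ultimately show ?thesis
    by (simp add: inner_symbol_def sum_distrib_left power_mult_distrib mult_ac)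
qed

lemma inner_symbol_pos: "u > 0 \<Longrightarrow> inner_symbol u > 0"
  using \<phi>_pos by (simp add: inner_symbol_eq add_pos_nonneg)

lemma inner_symbol_powr:
  assumes "u > 0"
  shows "inner_symbol u powr (\<gamma> / real n) = levy_symbol \<gamma> \<mu> \<rho> \<phi> u"
proof -
  define m where "m = real n"
  have m: "m > 0" using \<gamma>_pos by (simp add: m_def)
  have pos: "1 + \<phi> * u powr (- \<rho>) > 0" using \<phi>_pos by (simp add: add_pos_nonneg)
  have "(1 + \<phi> * u powr (- \<rho>)) ^ n = (1 + \<phi> * u powr (- \<rho>)) powr m"
    unfolding m_def by (rule powr_realpow[OF pos, symmetric])
  then have "((1 + \<phi> * u powr (- \<rho>)) ^ n) powr (\<gamma> / m) = (1 + \<phi> * u powr (- \<rho>)) powr \<gamma>"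
    using m by (simp add: powr_powr)
  moreover have "(u powr (\<mu> * m / \<gamma>)) powr (\<gamma> / m) = u powr \<mu>"
    using m \<gamma>_pos by (simp add: powr_powr)
  ultimately show ?thesis
    using pos unfolding m_def[symmetric]
    by (simp add: inner_symbol_eq[OF assms, folded m_def] levy_symbol_def powr_mult)
qed

lemma paths_AE:
  "AE \<omega> in C. subordinator_path (\<lambda>t. W t \<omega>) \<and> (\<forall>r\<in>{0..n}. subordinator_path (\<lambda>t. U r t \<omega>))"
proof (rule AE_completion)
  have "AE \<omega> in M. \<forall>r\<in>{0..n}. subordinator_path (\<lambda>t. U r t \<omega>)"
    using U by (intro AE_finite_allI) (auto intro: stable_subordinator_subordinator_path)
  with stable_subordinator_subordinator_path[OF W]
  show "AE \<omega> in M. subordinator_path (\<lambda>t. W t \<omega>) \<and> (\<forall>r\<in>{0..n}. subordinator_path (\<lambda>t. U r t \<omega>))"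
    by eventually_elim auto
qed

lemma subordinator_path_V:
  assumes "subordinator_path (\<lambda>t. W t \<omega>)" "\<forall>r\<in>{0..n}. subordinator_path (\<lambda>t. U r t \<omega>)"
  shows "subordinator_path (\<lambda>t. V t \<omega>)"
  unfolding subordinated_sum_def
proof (rule subordinator_path_sum)
  fix r assume "r \<in> {0..n}"
  with assms have "subordinator_path (\<lambda>t. U r t \<omega>)" by blast
  from subordinator_path_compose[OF this subordinator_path_scale[OF assms(1) rate_nonneg]]
  show "subordinator_path (\<lambda>t. U r (rate r * W t \<omega>) \<omega>)" by simp
qed

lemma subordinator_path_V_AE: "AE \<omega> in C. subordinator_path (\<lambda>t. V t \<omega>)"
  using paths_AE by eventually_elim (use subordinator_path_V in auto)

text \<open>
  The indicator of an event of the inner subordinator and the exponentials of the outer ones are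
  independent factors.
\<close>

lemma joint_laplace:
  assumes "s \<ge> 0" "t \<ge> 0" "u > 0" and A: "A \<in> sets borel"
  shows "(LINT \<omega>|M. indicator A (W s \<omega>) * exp (- u * (\<Sum>r = 0..n. U r (rate r * t) \<omega>))) =
    (LINT \<omega>|M. indicator A (W s \<omega>)) * exp (- inner_symbol u * t)"
proof -
  let ?I = "insert None (Some ` {0..n})"
  define f :: "nat option \<Rightarrow> (real \<Rightarrow> real) \<Rightarrow> real" where
    "f i x = (case i of None \<Rightarrow> indicator A (x s) | Some r \<Rightarrow> exp (- u * x (rate r * t)))" for i x
  define X where "X i \<omega> = f i (sample_path (case i of None \<Rightarrow> W | Some r \<Rightarrow> U r) \<omega>)" for i \<omega>
  have nn: "rate r * t \<ge> 0" for r using rate_nonneg assms by simp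
  have X_None: "X None \<omega> = indicator A (W s \<omega>)" for \<omega>
    using assms by (simp add: X_def f_def sample_path_def)
  have X_Some: "X (Some r) \<omega> = exp (- u * U r (rate r * t) \<omega>)" for r \<omega>
    using nn[of r] by (simp add: X_def f_def sample_path_def)
  have "indep_vars (\<lambda>_. borel) X ?I"
    unfolding X_def[abs_def]
  proof (rule indep_vars_compose2[where Y = f])
    show "indep_vars (\<lambda>_. \<Pi>\<^sub>M t\<in>{0..}. borel) (\<lambda>i. sample_path (case i of None \<Rightarrow> W | Some r \<Rightarrow> U r)) ?I"
      using indep by (simp add: indep_subordinators_def)
    show "f i \<in> borel_measurable (\<Pi>\<^sub>M t\<in>{0..}. borel)" for i
    proof (cases i)
      case None
      have [measurable]: "(\<lambda>x. x s) \<in> borel_measurable (\<Pi>\<^sub>M t\<in>{0::real..}. (borel :: real measure))"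
        by (rule measurable_component_singleton) (use assms in simp)
      show ?thesis using A unfolding None f_def[abs_def] by simp
    next
      case (Some r)
      have [measurable]: "(\<lambda>x. x (rate r * t)) \<in> borel_measurable (\<Pi>\<^sub>M t\<in>{0::real..}. (borel :: real measure))"
        by (rule measurable_component_singleton) (use nn in simp)
      show ?thesis unfolding Some f_def[abs_def] by simp
    qed
  qed
  moreover have "integrable M (X i)" if "i \<in> ?I" for i
  proof (rule integrable_const_bound[of _ 1])
    show "X i \<in> borel_measurable M"
      using \<open>indep_vars (\<lambda>_. borel) X ?I\<close> that by (auto simp: indep_vars_def)
    show "AE \<omega> in M. norm (X i \<omega>) \<le> 1"
    proof (cases i)
      case (Some r)
      then have "AE \<omega> in M. subordinator_path (\<lambda>t. U r t \<omega>)"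
        using that by (intro stable_subordinator_subordinator_path[OF U]) auto
      then show ?thesis
        by eventually_elim (use Some X_Some nn[of r] assms in \<open>auto dest: subordinator_pathD(3)\<close>)
    qed (simp add: X_None indicator_def)
  qed
  ultimately have "(LINT \<omega>|M. (\<Prod>i\<in>?I. X i \<omega>)) = (\<Prod>i\<in>?I. (LINT \<omega>|M. X i \<omega>))"
    by (intro indep_vars_lebesgue_integral) auto
  moreover have "(\<Prod>i\<in>?I. X i \<omega>) = indicator A (W s \<omega>) * exp (- u * (\<Sum>r = 0..n. U r (rate r * t) \<omega>))" for \<omega>
    by (subst prod.insert) (auto simp: prod.reindex X_None X_Some exp_sum[symmetric] sum_distrib_left)
  moreover have "(\<Prod>i\<in>?I. (LINT \<omega>|M. X i \<omega>)) = (LINT \<omega>|M. indicator A (W s \<omega>)) * exp (- inner_symbol u * t)"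
  proof -
    have "(\<Prod>r = 0..n. (LINT \<omega>|M. X (Some r) \<omega>)) = (\<Prod>r = 0..n. exp (- (rate r * t) * u powr index r))"
      unfolding X_Some using U nn \<open>u > 0\<close> by (intro prod.cong refl stable_subordinator_laplace) auto
    also have "\<dots> = exp (- inner_symbol u * t)"
      unfolding inner_symbol_def sum_negf[symmetric] sum_distrib_right
      by (subst exp_sum[symmetric]) (auto simp: mult_ac intro!: arg_cong[where f = exp] sum.cong)
    finally show ?thesis
      unfolding X_None[abs_def, symmetric] by (subst prod.insert) (auto simp: prod.reindex)
  qed
  ultimately show ?thesis by simp
qed

text \<open>
  The outer subordinators, run jointly at the rates, form a process that is independent of the
  inner one; \<open>V\<^sub>s\<close> is its value at the random time \<open>W\<^sub>s\<close>.
\<close>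

lemma laplace_V:
  assumes "s \<ge> 0" "u > 0"
  shows "(\<lambda>\<omega>. exp (- u * V s \<omega>)) \<in> borel_measurable C"
    and "(LINT \<omega>|C. exp (- u * V s \<omega>)) = exp (- levy_symbol \<gamma> \<mu> \<rho> \<phi> u * s)"
proof -
  define Y where "Y t \<omega> = exp (- u * (\<Sum>r = 0..n. U r (rate r * t) \<omega>))" for t \<omega>
  define H where "H t = exp (- inner_symbol u * t)" for t
  have W_meas [measurable]: "W s \<in> borel_measurable M" by (rule stable_subordinator_measurable[OF W assms(1)])
  have Y_meas: "Y t \<in> borel_measurable M" if "t \<ge> 0" for t
  proof -
    have "U r (rate r * t) \<in> borel_measurable M" if "r \<in> {0..n}" for r
      using U[of r] that rate_nonneg[of r] \<open>t \<ge> 0\<close> by (intro stable_subordinator_measurable[of M _ "U r"]) auto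
    then have [measurable]: "(\<lambda>\<omega>. \<Sum>r = 0..n. U r (rate r * t) \<omega>) \<in> borel_measurable M"
      by (intro borel_measurable_sum)
    show ?thesis unfolding Y_def[abs_def] by measurable
  qed
  have good: "AE \<omega> in C. subordinator_path (\<lambda>t. \<Sum>r = 0..n. U r (rate r * t) \<omega>)"
    using paths_AE
  proof eventually_elim
    case (elim \<omega>)
    have id: "subordinator_path (\<lambda>t. t)" by (simp add: subordinator_path_def mono_on_def)
    show ?case
    proof (rule subordinator_path_sum)
      fix r assume "r \<in> {0..n}"
      with elim have "subordinator_path (\<lambda>t. U r t \<omega>)" by blast
      from subordinator_path_compose[OF this subordinator_path_scale[OF id rate_nonneg]]
      show "subordinator_path (\<lambda>t. U r (rate r * t) \<omega>)" by simp
    qed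
  qed
  have VY: "Y (W s \<omega>) \<omega> = exp (- u * V s \<omega>)" for \<omega>
    by (simp add: Y_def subordinated_sum_def)
  have S: "inner_symbol u > 0" by (rule inner_symbol_pos[OF assms(2)])
  have "(\<lambda>\<omega>. Y (W s \<omega>) \<omega>) \<in> borel_measurable C \<and>
    (LINT \<omega>|C. Y (W s \<omega>) \<omega>) = (LINT \<omega>|C. H (W s \<omega>))"
  proof (rule C.expectation_at_independent_time[where Y = Y and \<tau> = "W s" and H = H])
    show "complete_measure C" by (rule completion.complete_measure_axioms)
    show "Y t \<in> borel_measurable C" if "t \<ge> 0" for t by (rule measurable_completion[OF Y_meas[OF that]])
    show "W s \<in> borel_measurable C" by (rule measurable_completion[OF W_meas])
    show "AE \<omega> in C. 0 \<le> W s \<omega>"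
      using paths_AE by eventually_elim (use assms in \<open>auto dest: subordinator_pathD(3)\<close>)
    show "AE \<omega> in C. \<forall>t\<ge>0. continuous (at_right t) (\<lambda>t. Y t \<omega>)"
      using good
    proof eventually_elim
      case (elim \<omega>)
      have "continuous (at_right t) (\<lambda>t. \<Sum>r = 0..n. U r (rate r * t) \<omega>)" if "t \<ge> 0" for t
        by (rule subordinator_pathD(4)[OF elim that])
      then show ?case unfolding Y_def by (intro allI impI continuous_exp continuous_mult continuous_const)
    qed
    show "AE \<omega> in C. \<forall>t\<ge>0. \<bar>Y t \<omega>\<bar> \<le> 1"
      using good
    proof eventually_elim
      case (elim \<omega>)
      have "Y t \<omega> \<le> 1" if "t \<ge> 0" for t
        using subordinator_pathD(3)[OF elim that] assms unfolding Y_def by (simp only: exp_le_one_iff mult_minus_left) simp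
      then show ?case by (simp add: Y_def)
    qed
    show "continuous_on UNIV H" unfolding H_def by (intro continuous_intros)
    show "\<bar>H t\<bar> \<le> 1" if "t \<ge> 0" for t using S that by (simp add: H_def)
    fix t :: real and A :: "real set" assume t: "t \<ge> 0" and A: "A \<in> sets borel"
    have [measurable]: "A \<in> sets borel" by (rule A)
    note [measurable] = Y_meas[OF t]
    have "(LINT \<omega>|M. indicator A (W s \<omega>) * Y t \<omega>) = (LINT \<omega>|M. indicator A (W s \<omega>)) * H t"
      using joint_laplace[OF assms(1) t assms(2) A] by (simp add: Y_def H_def)
    then show "(LINT \<omega>|C. indicator A (W s \<omega>) * Y t \<omega>) = (LINT \<omega>|C. indicator A (W s \<omega>)) * H t"
      by (subst (1 2) integral_completion) measurable
  qed
  note * = conjunct1[OF this] conjunct2[OF this]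
  show "(\<lambda>\<omega>. exp (- u * V s \<omega>)) \<in> borel_measurable C" using *(1) by (simp add: VY)
  have "(LINT \<omega>|C. H (W s \<omega>)) = (LINT \<omega>|M. exp (- inner_symbol u * W s \<omega>))"
    unfolding H_def by (rule integral_completion) measurable
  also have "\<dots> = exp (- s * inner_symbol u powr (\<gamma> / real n))"
    by (rule stable_subordinator_laplace[OF W assms(1) S])
  finally show "(LINT \<omega>|C. exp (- u * V s \<omega>)) = exp (- levy_symbol \<gamma> \<mu> \<rho> \<phi> u * s)"
    using *(2) by (simp add: VY inner_symbol_powr[OF assms(2)] mult.commute)
qed

text \<open>
  The paths are unbounded because \<open>E exp (- V\<^sub>i) = exp (- i \<psi>(1))\<close> tends to
  \<open>0\<close>, so that the infimum over \<open>i\<close> of \<open>exp (- V\<^sub>i)\<close> vanishes almost surely.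
  This makes the hitting times almost surely finite.
\<close>

lemma V_unbounded: "AE \<omega> in C. \<forall>t. \<exists>s\<ge>0. V s \<omega> > t"
proof -
  let ?\<psi> = "levy_symbol \<gamma> \<mu> \<rho> \<phi> 1"
  have \<psi>: "?\<psi> > 0" by (rule levy_symbol_pos) simp
  have [measurable]: "(\<lambda>\<omega>. exp (- V (real i) \<omega>)) \<in> borel_measurable C" for i
    using laplace_V(1)[of "real i" 1] by simp
  let ?I = "\<lambda>\<omega>. INF i. ennreal (exp (- V (real i) \<omega>))"
  have le: "(\<integral>\<^sup>+ \<omega>. ?I \<omega> \<partial>C) \<le> ennreal (exp (- ?\<psi> * real i))" for i :: nat
  proof -
    have L: "(LINT \<omega>|C. exp (- V (real i) \<omega>)) = exp (- ?\<psi> * real i)"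
      using laplace_V(2)[of "real i" 1] by simp
    then have "integrable C (\<lambda>\<omega>. exp (- V (real i) \<omega>))"
      using not_integrable_integral_eq[of C "\<lambda>\<omega>. exp (- V (real i) \<omega>)"] by force
    then have "(\<integral>\<^sup>+ \<omega>. ennreal (exp (- V (real i) \<omega>)) \<partial>C) = ennreal (exp (- ?\<psi> * real i))"
      using L by (subst nn_integral_eq_integral) auto
    moreover have "(\<integral>\<^sup>+ \<omega>. ?I \<omega> \<partial>C) \<le> (\<integral>\<^sup>+ \<omega>. ennreal (exp (- V (real i) \<omega>)) \<partial>C)"
      by (intro nn_integral_mono INF_lower) auto
    ultimately show ?thesis by simp
  qed
  have "(\<lambda>i. ennreal (exp (- ?\<psi> * real i))) \<longlonglongrightarrow> ennreal 0"
  proof (rule tendsto_ennrealI)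
    have "filterlim (\<lambda>i. ?\<psi> * real i) at_top sequentially"
      using \<psi> by (intro filterlim_tendsto_pos_mult_at_top[OF tendsto_const] filterlim_real_sequentially)
    then have "filterlim (\<lambda>i. - ?\<psi> * real i) at_bot sequentially"
      by (simp add: filterlim_uminus_at_top)
    then show "(\<lambda>i. exp (- ?\<psi> * real i)) \<longlonglongrightarrow> 0"
      by (rule filterlim_compose[OF exp_at_bot])
  qed
  then have "(\<integral>\<^sup>+ \<omega>. ?I \<omega> \<partial>C) \<le> 0"
    using le by (intro LIMSEQ_le_const) auto
  then have "AE \<omega> in C. ?I \<omega> = 0"
    by (subst (asm) le_zero_eq, subst (asm) nn_integral_0_iff_AE) auto
  then show ?thesis
  proof eventually_elim
    case (elim \<omega>)
    show ?case
    proof (intro allI, rule ccontr)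
      fix t assume "\<not> (\<exists>s\<ge>0. V s \<omega> > t)"
      then have "V (real i) \<omega> \<le> t" for i :: nat by (meson not_less of_nat_0_le_iff)
      then have "ennreal (exp (- t)) \<le> ?I \<omega>" by (intro INF_greatest ennreal_leI) auto
      with elim show False by simp
    qed
  qed
qed

lemma V_paths: "AE \<omega> in C. subordinator_path (\<lambda>s. V s \<omega>) \<and> (\<forall>t. \<exists>s\<ge>0. V s \<omega> > t)"
  using subordinator_path_V_AE V_unbounded by eventually_elim auto

end

section \<open>The Poisson process at the hitting time\<close>

lemma right_continuous_nat_indicator:
  fixes f :: "real \<Rightarrow> nat"
  assumes "continuous (at_right t) (\<lambda>t. real (f t))"
  shows "continuous (at_right t) (\<lambda>t. indicator {k} (f t) :: real)"
proof -
  have "((\<lambda>t. real (f t)) \<longlongrightarrow> real (f t)) (at_right t)" using assms by (simp add: continuous_within)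
  then have "\<forall>\<^sub>F s in at_right t. dist (real (f s)) (real (f t)) < 1" by (rule tendstoD) simp
  then have "\<forall>\<^sub>F s in at_right t. indicator {k} (f s) = (indicator {k} (f t) :: real)"
  proof eventually_elim
    case (elim s)
    then have "real (f s) < real (f t + 1)" "real (f t) < real (f s + 1)" by (auto simp: dist_real_def)
    then have "f s = f t" unfolding of_nat_less_iff by simp
    then show ?case by simp
  qed
  then show ?thesis by (simp add: continuous_within tendsto_eventually)
qed

text \<open>
  The factorisation at a random time is applied to the indicator of the state \<open>k\<close>:
  a right-continuous path with values in the naturals is locally constant on the right, so its indicators are right-continuous.
\<close>

lemma poisson_process_at_independent_time:
  assumes P: "poisson_process M \<Lambda> P" and "\<Lambda> > 0"
    and indep: "indep_of_hitting_time M P E" and nonneg: "AE \<omega> in completion M. E t \<omega> \<ge> 0" and t: "t \<ge> 0"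
  shows "(\<lambda>\<omega>. P (E t \<omega>) \<omega>) \<in> measurable (completion M) (count_space UNIV)"
    and "measure (completion M) {\<omega> \<in> space M. P (E t \<omega>) \<omega> = k} =
      (LINT \<omega>|completion M. poisson_weight \<Lambda> k (E t \<omega>))"
proof -
  let ?C = "completion M"
  interpret M: prob_space M using P by (simp add: poisson_process_def levy_process_def)
  interpret prob_space ?C by (rule M.prob_space_completion)
  have P_meas [measurable]: "P s \<in> measurable M (count_space UNIV)" if "s \<ge> 0" for s
  proof -
    have [measurable]: "(\<lambda>\<omega>. real (P s \<omega>)) \<in> borel_measurable M"
      using P that by (simp add: poisson_process_def levy_process_def)
    have "(\<lambda>\<omega>. nat \<lfloor>real (P s \<omega>)\<rfloor>) \<in> measurable M (count_space UNIV)" by measurable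
    then show ?thesis by simp
  qed
  have comp: "(\<lambda>x. x s) \<in> borel_measurable (\<Pi>\<^sub>M s\<in>{0::real..}. (borel :: real measure))" if "s \<ge> 0" for s
    by (rule measurable_component_singleton) (use that in simp)
  have iv: "indep_var (\<Pi>\<^sub>M s\<in>{0..}. borel) (sample_path (\<lambda>t \<omega>. real (P t \<omega>))) (\<Pi>\<^sub>M s\<in>{0..}. borel) (sample_path E)"
    using indep by (simp add: indep_of_hitting_time_def)
  have E_meas [measurable]: "E t \<in> borel_measurable ?C"
    using measurable_compose[OF indep_var_rv2[OF iv] comp[OF t]] t by (simp add: sample_path_def)
  have rc: "AE \<omega> in ?C. \<forall>s\<ge>0. continuous (at_right s) (\<lambda>s. real (P s \<omega>))"
  proof (rule AE_completion)
    have "AE \<omega> in M. cadlag (\<lambda>s. real (P s \<omega>))"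
      using P by (simp add: poisson_process_def levy_process_def)
    then show "AE \<omega> in M. \<forall>s\<ge>0. continuous (at_right s) (\<lambda>s. real (P s \<omega>))"
      by eventually_elim (simp add: cadlag_def)
  qed
  \<comment> \<open>The value of the process at the random time is handled through the indicators of its states.\<close>
  have *: "(\<lambda>\<omega>. indicator {k} (P (E t \<omega>) \<omega>) :: real) \<in> borel_measurable ?C \<and>
    (LINT \<omega>|?C. indicator {k} (P (E t \<omega>) \<omega>)) = (LINT \<omega>|?C. poisson_weight \<Lambda> k (E t \<omega>))" for k
  proof -
    show ?thesis
    proof (rule expectation_at_independent_time[where Y = "\<lambda>s \<omega>. indicator {k} (P s \<omega>)" and \<tau> = "E t"
        and H = "poisson_weight \<Lambda> k"])
      show "complete_measure ?C" by (rule completion.complete_measure_axioms)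
      show ind_meas: "(\<lambda>\<omega>. indicator {k} (P s \<omega>) :: real) \<in> borel_measurable ?C" if "s \<ge> 0" for s
      proof (rule measurable_completion)
        show "(\<lambda>\<omega>. indicator {k} (P s \<omega>) :: real) \<in> borel_measurable M"
          by (rule measurable_compose[OF P_meas[OF that]]) simp
      qed
      show "E t \<in> borel_measurable ?C" by (rule E_meas)
      show "AE \<omega> in ?C. 0 \<le> E t \<omega>" by (rule nonneg)
      show "AE \<omega> in ?C. \<forall>s\<ge>0. continuous (at_right s) (\<lambda>s. indicator {k} (P s \<omega>) :: real)"
        using rc by eventually_elim (auto intro: right_continuous_nat_indicator)
      show "AE \<omega> in ?C. \<forall>s\<ge>0. \<bar>indicator {k} (P s \<omega>) :: real\<bar> \<le> 1" by (simp add: indicator_def)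
      show "continuous_on UNIV (poisson_weight \<Lambda> k)" by (rule poisson_weight_continuous)
      show "\<bar>poisson_weight \<Lambda> k s\<bar> \<le> 1" if "s \<ge> 0" for s
        using poisson_weight_bounds[of \<Lambda> s k] that \<open>\<Lambda> > 0\<close> by simp
      fix s :: real and A :: "real set" assume s: "s \<ge> 0" and A: "A \<in> sets borel"
      have [measurable]: "A \<in> sets borel" by (rule A)
      let ?f = "\<lambda>x. indicator {real k} (x s) :: real" and ?g = "\<lambda>x. indicator A (x t) :: real"
      have "indep_var borel (?f \<circ> sample_path (\<lambda>t \<omega>. real (P t \<omega>))) borel (?g \<circ> sample_path E)"
      proof (rule indep_var_compose[OF iv])
        show "?f \<in> borel_measurable (\<Pi>\<^sub>M s\<in>{0..}. borel)"
          using comp[OF s] by measurable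
        show "?g \<in> borel_measurable (\<Pi>\<^sub>M s\<in>{0..}. borel)"
          using comp[OF t] by measurable
      qed
      moreover have "?f \<circ> sample_path (\<lambda>t \<omega>. real (P t \<omega>)) = (\<lambda>\<omega>. indicator {k} (P s \<omega>))"
        using s by (auto simp: sample_path_def indicator_def fun_eq_iff)
      moreover have "?g \<circ> sample_path E = (\<lambda>\<omega>. indicator A (E t \<omega>))"
        using t by (auto simp: sample_path_def fun_eq_iff)
      ultimately have iv': "indep_var borel (\<lambda>\<omega>. indicator {k} (P s \<omega>) :: real) borel (\<lambda>\<omega>. indicator A (E t \<omega>) :: real)"
        by simp
      have int: "integrable ?C (\<lambda>\<omega>. indicator {k} (P s \<omega>) :: real)"
        by (rule integrable_const_bound[of _ 1]) (use ind_meas[OF s] in \<open>auto simp: indicator_def\<close>)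
      have int': "integrable ?C (\<lambda>\<omega>. indicator A (E t \<omega>) :: real)"
        by (rule integrable_const_bound[of _ 1]) (auto simp: indicator_def)
      have "(LINT \<omega>|?C. indicator {k} (P s \<omega>)) = poisson_weight \<Lambda> k s"
      proof -
        have "(LINT \<omega>|?C. indicator {k} (P s \<omega>)) = (LINT \<omega>|M. indicator {k} (P s \<omega>) :: real)"
          by (rule integral_completion) (rule measurable_compose[OF P_meas[OF s]], simp)
        also have "\<dots> = (LINT \<omega>|M. indicator {\<omega> \<in> space M. P s \<omega> = k} \<omega>)"
          by (intro Bochner_Integration.integral_cong) (auto simp: indicator_def)
        also have "\<dots> = measure M {\<omega> \<in> space M. P s \<omega> = k}"
          by (subst Bochner_Integration.integral_indicator) (auto intro!: arg_cong[where f = "measure M"])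
        also have "\<dots> = poisson_weight \<Lambda> k s"
          using P s by (simp add: poisson_process_def poisson_weight_def)
        finally show ?thesis .
      qed
      then show "(LINT \<omega>|?C. indicator A (E t \<omega>) * indicator {k} (P s \<omega>)) =
          (LINT \<omega>|?C. indicator A (E t \<omega>)) * poisson_weight \<Lambda> k s"
        using indep_var_lebesgue_integral[OF iv' int int'] by (simp add: mult.commute)
    qed
  qed
  have sets: "{\<omega> \<in> space M. P (E t \<omega>) \<omega> = k} \<in> sets ?C" for k
  proof -
    have "(\<lambda>\<omega>. indicator {k} (P (E t \<omega>) \<omega>) :: real) -` {1} \<inter> space ?C \<in> sets ?C"
      using * by (intro measurable_sets[of _ ?C borel]) auto
    moreover have "(\<lambda>\<omega>. indicator {k} (P (E t \<omega>) \<omega>) :: real) -` {1} \<inter> space ?C = {\<omega> \<in> space M. P (E t \<omega>) \<omega> = k}"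
      by (auto simp: indicator_def split: if_splits)
    ultimately show ?thesis by simp
  qed
  show "(\<lambda>\<omega>. P (E t \<omega>) \<omega>) \<in> measurable ?C (count_space UNIV)"
  proof (rule measurable_count_space_eq2_countable[THEN iffD2])
    show "(\<lambda>\<omega>. P (E t \<omega>) \<omega>) \<in> space ?C \<rightarrow> UNIV \<and>
      (\<forall>k\<in>UNIV. (\<lambda>\<omega>. P (E t \<omega>) \<omega>) -` {k} \<inter> space ?C \<in> sets ?C)"
      using sets by (auto simp: vimage_def Int_def conj_commute)
  qed
  have "measure ?C {\<omega> \<in> space M. P (E t \<omega>) \<omega> = k} = (LINT \<omega>|?C. indicator {\<omega> \<in> space M. P (E t \<omega>) \<omega> = k} \<omega>)"
    by (subst Bochner_Integration.integral_indicator) (auto intro!: arg_cong[where f = "measure ?C"])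
  also have "\<dots> = (LINT \<omega>|?C. indicator {k} (P (E t \<omega>) \<omega>))"
    by (intro Bochner_Integration.integral_cong) (auto simp: indicator_def)
  finally show "measure ?C {\<omega> \<in> space M. P (E t \<omega>) \<omega> = k} = (LINT \<omega>|?C. poisson_weight \<Lambda> k (E t \<omega>))"
    using * by simp
qed

theorem theorem5p5:
  fixes \<Lambda> \<phi> \<gamma> \<rho> \<mu> :: real
    and M :: "'a measure" and N :: "real \<Rightarrow> 'a \<Rightarrow> nat"
    and M' :: "'b measure" and U :: "nat \<Rightarrow> real \<Rightarrow> 'b \<Rightarrow> real" and W :: "real \<Rightarrow> 'b \<Rightarrow> real"
    and P :: "real \<Rightarrow> 'b \<Rightarrow> nat" and E :: "real \<Rightarrow> 'b \<Rightarrow> real"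
  assumes "\<Lambda> > 0" and "\<phi> > 0" and "\<gamma> > 0"
    and "0 < \<rho>" and "\<rho> \<le> 1" and "0 < \<mu>" and "\<mu> \<le> 1"
    and "\<And>r. r \<le> nat \<lceil>\<gamma>\<rceil> \<Longrightarrow>
           0 < \<mu> * real (nat \<lceil>\<gamma>\<rceil>) / \<gamma> - real r * \<rho> \<and>
           \<mu> * real (nat \<lceil>\<gamma>\<rceil>) / \<gamma> - real r * \<rho> < 1"
    and "generalized_fractional_poisson_process M \<Lambda> \<phi> \<gamma> \<rho> \<mu> N"
    and "prob_space M'"
    and "\<And>r. r \<le> nat \<lceil>\<gamma>\<rceil> \<Longrightarrow>
           stable_subordinator M' (\<mu> * real (nat \<lceil>\<gamma>\<rceil>) / \<gamma> - real r * \<rho>) (U r)"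
    and "stable_subordinator M' (\<gamma> / real (nat \<lceil>\<gamma>\<rceil>)) W"
    and "indep_subordinators M' (nat \<lceil>\<gamma>\<rceil>) U W"
    and "E = hitting_time (subordinated_sum \<gamma> \<phi> U W)"
    and "poisson_process M' \<Lambda> P"
    and "indep_of_hitting_time M' P E"
  shows "\<forall>t\<ge>0.
      (\<lambda>\<omega>. P (E t \<omega>) \<omega>) \<in> measurable (completion M') (count_space UNIV) \<and>
      distr M (count_space UNIV) (N t) =
        distr (completion M') (count_space UNIV) (\<lambda>\<omega>. P (E t \<omega>) \<omega>)"
proof -
  note \<Lambda> = assms(1) and gfpp = assms(9) and E_def = assms(14) and P = assms(15) and PE = assms(16)
  \<comment> \<open>The index for \<open>r = 0\<close> is less than \<open>1\<close>, and \<open>\<gamma> \<le> \<lceil>\<gamma>\<rceil>\<close>.\<close>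
  have "\<mu> < 1"
  proof -
    have "\<mu> * real (nat \<lceil>\<gamma>\<rceil>) < \<gamma>" using assms(8)[of 0] \<open>\<gamma> > 0\<close> by (simp add: divide_less_eq)
    also have "\<gamma> \<le> real (nat \<lceil>\<gamma>\<rceil>)" by (rule real_nat_ceiling_ge)
    finally have "\<mu> * real (nat \<lceil>\<gamma>\<rceil>) < 1 * real (nat \<lceil>\<gamma>\<rceil>)" by simp
    then show ?thesis by (rule mult_right_less_imp_less) simp
  qed
  interpret subordination \<gamma> \<mu> \<rho> \<phi> M' U W
    by (intro subordination.intro prabhakar.intro subordination_axioms.intro assms \<open>\<mu> < 1\<close>)
  interpret M: prob_space M using gfpp by (simp add: generalized_fractional_poisson_process_def)
  have E: "E t \<omega> = Inf {s. 0 \<le> s \<and> V s \<omega> > t}" for t \<omega>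
    by (simp add: E_def hitting_time_def)
  have E_meas: "E t \<in> borel_measurable C" if "t \<ge> 0" for t
  proof -
    have "sample_path E \<in> measurable C (\<Pi>\<^sub>M s\<in>{0..}. borel)"
      using PE unfolding indep_of_hitting_time_def by (rule C.indep_var_rv2)
    from measurable_compose[OF this measurable_component_singleton[of t]] that
    show ?thesis by (simp add: sample_path_def)
  qed
  have E_nonneg: "AE \<omega> in C. E t \<omega> \<ge> 0" for t
    using V_paths
  proof eventually_elim
    case (elim \<omega>)
    then show ?case by (intro inverse_path_nonneg[of "\<lambda>s. V s \<omega>" "\<lambda>t. E t \<omega>"]) (auto simp: E)
  qed
  note PE_meas = poisson_process_at_independent_time(1)[OF P \<Lambda> PE E_nonneg]
  note PE_prob = poisson_process_at_independent_time(2)[OF P \<Lambda> PE E_nonneg]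
  define p where "p = state_prob M N"
  define q where "q k t = (LINT \<omega>|C. poisson_weight \<Lambda> k (E t \<omega>))" for k t
  have weight_bound: "\<bar>poisson_weight \<Lambda> k x\<bar> \<le> 1" if "x \<ge> 0" for k x
    using poisson_weight_bounds[of \<Lambda> x k] that \<Lambda> by simp
  have q_rc: "continuous (at_right t) (q k)" if "t \<ge> 0" for k t
    unfolding q_def[abs_def]
    by (rule C.expectation_inverse_process_right_continuous
        [OF V_paths E E_meas poisson_weight_continuous weight_bound that])
  have q_bound: "\<bar>q k t\<bar> \<le> 1" if "t \<ge> 0" for k t
    unfolding q_def PE_prob[OF that, symmetric] by (simp add: C.prob_le_1)
  have deriv_int: "set_integrable lborel {0<..} (poisson_weight_deriv \<Lambda> k)" for k
    using poisson_weight_deriv_laplace[of \<Lambda> 0 k] \<Lambda>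
    by (simp add: set_integrable_def has_bochner_integral_iff)
  have FTC: "(LINT s:{0<..<x}|lborel. poisson_weight_deriv \<Lambda> k s) = poisson_weight \<Lambda> k x - poisson_weight \<Lambda> k 0"
    if "x \<ge> 0" for k x
  proof (rule integral_of_derivative[OF that])
    show "continuous_on {0..x} (poisson_weight \<Lambda> k)"
      by (rule continuous_on_subset[OF poisson_weight_continuous]) simp
    show "set_integrable lborel {0<..<x} (poisson_weight_deriv \<Lambda> k)"
      by (rule set_integrable_subset[OF deriv_int]) auto
  qed (rule poisson_weight_has_derivative)
  have inverse: "(LINT t:{0<..}|lborel. exp (- u * t) * q k t) =
      levy_symbol \<gamma> \<mu> \<rho> \<phi> u * \<Lambda> ^ k / (u * (levy_symbol \<gamma> \<mu> \<rho> \<phi> u + \<Lambda>) ^ (k + 1))"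
    and q_meas: "(\<lambda>t. indicator {0<..} t * q k t) \<in> borel_measurable lborel"
    if u: "u > 0" for u k
  proof -
    let ?\<psi> = "levy_symbol \<gamma> \<mu> \<rho> \<phi> u"
    have \<psi>: "?\<psi> \<ge> 0" using levy_symbol_pos[OF u] by simp
    note laplace = C.laplace_of_inverse_process[where E = E and h = "poisson_weight \<Lambda> k"
        and \<psi> = ?\<psi> and u = u, OF V_paths E E_meas laplace_V(2)[OF _ u] u
        poisson_weight_continuous weight_bound FTC deriv_int]
    show "(\<lambda>t. indicator {0<..} t * q k t) \<in> borel_measurable lborel"
      unfolding q_def[abs_def] by (rule laplace(2))
    have "(LINT s:{0<..}|lborel. exp (- ?\<psi> * s) * poisson_weight_deriv \<Lambda> k s) =
        ?\<psi> * \<Lambda> ^ k / (?\<psi> + \<Lambda>) ^ (k + 1) - poisson_weight \<Lambda> k 0"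
      using poisson_weight_deriv_laplace[OF \<Lambda> \<psi>, of k]
      by (simp add: set_lebesgue_integral_def has_bochner_integral_iff poisson_weight_0)
    then show "(LINT t:{0<..}|lborel. exp (- u * t) * q k t) =
      ?\<psi> * \<Lambda> ^ k / (u * (?\<psi> + \<Lambda>) ^ (k + 1))"
      using laplace(1) unfolding q_def by (simp add: diff_divide_distrib mult.commute)
  qed
  have gfppD: "p k 0 = (if k = 0 then 1 else 0)" "continuous_on {0..} (p k)"
    "t > 0 \<Longrightarrow> p k differentiable at t"
    "t > 0 \<Longrightarrow> set_integrable lborel {0<..<t} (caputo_prabhakar_integrand \<gamma> \<mu> \<rho> (- \<phi>) (p k) t)"
    "t > 0 \<Longrightarrow> caputo_prabhakar \<gamma> \<mu> \<rho> (- \<phi>) (p k) t =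
      - \<Lambda> * p k t + \<Lambda> * (if k = 0 then 0 else p (k - 1) t)" for k t
    using gfpp by (auto simp: generalized_fractional_poisson_process_def p_def)
  have p_bound: "\<bar>p k t\<bar> \<le> 1" for k t
    by (simp add: p_def state_prob_def M.prob_le_1)
  have p_laplace: "(LINT t:{0<..}|lborel. exp (- u * t) * p k t) =
      levy_symbol \<gamma> \<mu> \<rho> \<phi> u * \<Lambda> ^ k / (u * (levy_symbol \<gamma> \<mu> \<rho> \<phi> u + \<Lambda>) ^ (k + 1))"
    if "u > 0" "\<phi> * u powr (- \<rho>) < 1" for u k
    by (rule laplace_state_probabilities[OF that \<Lambda> gfppD(1) gfppD(2) gfppD(3) p_bound gfppD(4) gfppD(5)])
  obtain u0 where u0: "u0 > 0" "\<And>u. u \<ge> u0 \<Longrightarrow> \<phi> * u powr (- \<rho>) < 1" using laplace_threshold by blast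
  have pq: "p k t = q k t" if "t \<ge> 0" for k t
  proof -
    have p_meas: "(\<lambda>t. indicator {0<..} t * p k t) \<in> borel_measurable lborel"
      using measurable_continuous_halfline[OF gfppD(2)] by simp
    have q_meas': "(\<lambda>t. indicator {0<..} t * q k t) \<in> borel_measurable lborel"
      using q_meas[of 1] by simp
    have "p k t - q k t = 0"
    proof (rule laplace_transform_unique[where f = "\<lambda>t. p k t - q k t" and B = 2 and ?u0.0 = u0])
      show "(\<lambda>t. indicator {0<..} t * (p k t - q k t)) \<in> borel_measurable lborel"
        using borel_measurable_diff[OF p_meas q_meas'] by (simp add: right_diff_distrib)
      show "\<bar>p k t - q k t\<bar> \<le> 2" if "t > 0" for t
        using p_bound[of k t] q_bound[of t k] that by (simp add: abs_le_iff)
      show "continuous (at_right t) (\<lambda>t. p k t - q k t)" if "t \<ge> 0" for t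
      proof (intro continuous_diff q_rc that)
        have "continuous (at t within {0..}) (p k)"
          using gfppD(2)[of k] that by (simp add: continuous_on_eq_continuous_within)
        then show "continuous (at_right t) (p k)"
          by (rule continuous_within_subset) (use that in auto)
      qed
      show "(LINT t:{0<..}|lborel. exp (- u * t) * (p k t - q k t)) = 0" if "u \<ge> u0" for u
      proof -
        have u: "u > 0" "\<phi> * u powr (- \<rho>) < 1" using u0 that by (auto intro: less_le_trans)
        have "set_integrable lborel {0<..} (\<lambda>t. exp (- u * t) * p k t)"
          by (rule integrable_exp_bounded[OF u(1), where B = 1]) (use p_meas p_bound in auto)
        moreover have "set_integrable lborel {0<..} (\<lambda>t. exp (- u * t) * q k t)"
          by (rule integrable_exp_bounded[OF u(1), where B = 1]) (use q_meas' q_bound in auto)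
        ultimately show ?thesis
          using set_integral_diff(2) p_laplace[OF u, of k] inverse[OF u(1), of k]
          by (simp add: right_diff_distrib)
      qed
    qed (use u0 that in auto)
    then show ?thesis by simp
  qed
  show ?thesis
  proof (intro allI impI conjI)
    fix t :: real assume t: "t \<ge> 0"
    have N_meas: "N t \<in> measurable M (count_space UNIV)"
      using gfpp t by (simp add: generalized_fractional_poisson_process_def)
    show PE_meas': "(\<lambda>\<omega>. P (E t \<omega>) \<omega>) \<in> measurable C (count_space UNIV)" by (rule PE_meas[OF t])
    show "distr M (count_space UNIV) (N t) = distr C (count_space UNIV) (\<lambda>\<omega>. P (E t \<omega>) \<omega>)"
    proof (rule measure_eqI_countable[of _ UNIV])
      fix k :: nat
      have "measure M {\<omega> \<in> space M. N t \<omega> = k} = measure C {\<omega> \<in> space M'. P (E t \<omega>) \<omega> = k}"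
        using pq[OF t, of k] PE_prob[OF t, of k] by (simp add: p_def q_def state_prob_def)
      moreover have "N t -` {k} \<inter> space M = {\<omega> \<in> space M. N t \<omega> = k}"
        "(\<lambda>\<omega>. P (E t \<omega>) \<omega>) -` {k} \<inter> space C = {\<omega> \<in> space M'. P (E t \<omega>) \<omega> = k}" by auto
      ultimately show "emeasure (distr M (count_space UNIV) (N t)) {k} =
          emeasure (distr C (count_space UNIV) (\<lambda>\<omega>. P (E t \<omega>) \<omega>)) {k}"
        by (simp add: emeasure_distr[OF N_meas] emeasure_distr[OF PE_meas']
            M.emeasure_eq_measure C.emeasure_eq_measure)
    qed auto
  qed
qed

end
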